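(* Assume that the parameter function $c$ is real valued. Then the element $$C_2:=\tfrac14\sum_{\alpha,\beta>0}c_\alpha c_\beta\,\tilde s_\alpha\tilde s_\beta\in\mathbb{C}\tilde W\subset\mathbb{C}\hat W$$ is admissible, i.e. $C_2$ is central in $\mathbb{C}\hat W$ and $C_2^*=C_2$.
   Context: Setting. $(E,B)$ is a Euclidean space of dimension $n$ affording the reflection representation of a finite (real) reflection group $W\subset\mathsf{O}(E,B)$. $R\subset E^*$ is the root system, $R^\vee\subset E$ the dual root system with $\langle\alpha,\alpha^\vee\rangle=2$, where $\langle-,-\rangle$ is the natural pairing; $s_\alpha(y)=y-\langle\alpha,y\rangle\alpha^\vee$. A positive system $R_+$ (with simple roots $\Delta$) is fixed, sums over $\alpha>0$ are over $\alpha\in R_+$, and $c\colon R_+\to\mathbb{C}$, $\alpha\mapsto c_\alpha$, is a $W$-invariant parameter function. Put $\mathfrak{h}=E_{\mathbb{C}}$. $\mathcal{C}_{\mathbb{R}}$ is the real Clifford algebra generated by $E$ with relations $yy'+y'y=2B(y,y')$. Let $\varepsilon$ be its automorphism that is $-1$ on $E$, ${}^t$ its anti-automorphism that is the identity on $E$, and $\eta^*=\varepsilon(\eta^t)$. The group $\mathsf{Pin}$ consists of invertible $\eta\in\mathcal{C}_{\mathbb R}$ with $\varepsilon(\eta)y\eta^{-1}\in E$ for all $y\in E$ and $(\eta^*\eta)^2=1$; $p\colon\mathsf{Pin}\to\mathsf{O}(E,B)$, $p(\eta)y=\varepsilon(\eta)y\eta^{-1}$, is a double cover with kernel $\{\pm1\}$.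 $\tilde W=p^{-1}(W)$, with central element $\theta=-1\in\tilde W$ (in the abstract group algebra $\mathbb{C}\tilde W$, $\theta$ is a group element, not the scalar $-1$). For $\alpha\in R$, $\tilde s_\alpha=|\alpha^\vee|^{-1}\alpha^\vee\in\tilde W$, which satisfies $p(\tilde s_\alpha)=s_\alpha$. The star operation on $\mathbb{C}\tilde W$ is the anti-linear extension of the restriction of $*$ to $\tilde W$ (so $\tilde s_\alpha^*=\theta\tilde s_\alpha$, $\theta^*=\theta$). Let $w_0\in W$ be the longest element and $(-1)_{\mathfrak{h}}=-\mathrm{Id}\in\mathrm{End}(\mathfrak{h})$. If $w_0\ne(-1)_{\mathfrak h}$ set $\hat W=\tilde W$; if $w_0=(-1)_{\mathfrak h}$ set $\hat W=\tilde W\times C_2$, with $C_2$ here the cyclic group of order two generated by an element denoted $(-1)_{\mathfrak h}$, and $(-1)_{\mathfrak h}^*=(-1)_{\mathfrak h}$. An element $C\in\mathbb{C}\hat W$ is admissible if it is central in $\mathbb{C}\hat W$ and $C^*=C$. *)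

theory Defs
  imports
    "HOL-Analysis.Analysis"
    "HOL-Algebra.Generated_Groups"
    "HOL-Algebra.Elementary_Groups"
    "HOL-Algebra.Ring"
    "HOL-Library.Poly_Mapping"
begin

section \<open>The Clifford algebra of a Euclidean space\<close>

text \<open>
  The real Clifford algebra of a Euclidean space is given by generators and relations:
  formal expressions in vectors and real scalars, modulo the congruence generated by the axioms of
  unital associative real algebras, linearity in the generating vectors, and the relation
  \<open>y y' + y' y = 2 B(y, y')\<close>, where \<open>B\<close> is the inner product \<open>\<bullet>\<close> of the type class.
\<close>

datatype 'v clifford_expr =
    Vec 'v
  | Scal real
  | Add "'v clifford_expr" "'v clifford_expr"
  | Mul "'v clifford_expr" "'v clifford_expr"

inductive clifford_eq :: "'v::euclidean_space clifford_expr \<Rightarrow> 'v clifford_expr \<Rightarrow> bool" where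
  ce_refl: "clifford_eq a a"
| ce_sym: "clifford_eq a b \<Longrightarrow> clifford_eq b a"
| ce_trans: "clifford_eq a b \<Longrightarrow> clifford_eq b c \<Longrightarrow> clifford_eq a c"
| Add_cong: "clifford_eq a a' \<Longrightarrow> clifford_eq b b' \<Longrightarrow> clifford_eq (Add a b) (Add a' b')"
| Mul_cong: "clifford_eq a a' \<Longrightarrow> clifford_eq b b' \<Longrightarrow> clifford_eq (Mul a b) (Mul a' b')"
| Add_assoc: "clifford_eq (Add (Add a b) c) (Add a (Add b c))"
| Add_commute: "clifford_eq (Add a b) (Add b a)"
| Add_zero: "clifford_eq (Add (Scal 0) a) a"
| Add_minus: "clifford_eq (Add (Mul (Scal (-1)) a) a) (Scal 0)"
| Mul_assoc: "clifford_eq (Mul (Mul a b) c) (Mul a (Mul b c))"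
| Mul_one: "clifford_eq (Mul (Scal 1) a) a"
| Mul_Add: "clifford_eq (Mul a (Add b c)) (Add (Mul a b) (Mul a c))"
| Add_Mul: "clifford_eq (Mul (Add a b) c) (Add (Mul a c) (Mul b c))"
| Scal_add: "clifford_eq (Scal (r + s)) (Add (Scal r) (Scal s))"
| Scal_mult: "clifford_eq (Scal (r * s)) (Mul (Scal r) (Scal s))"
| Scal_central: "clifford_eq (Mul (Scal r) a) (Mul a (Scal r))"
| Vec_add: "clifford_eq (Vec (u + v)) (Add (Vec u) (Vec v))"
| Vec_scale: "clifford_eq (Vec (r *\<^sub>R v)) (Mul (Scal r) (Vec v))"
| Clifford: "clifford_eq (Add (Mul (Vec u) (Vec v)) (Mul (Vec v) (Vec u))) (Scal (2 * (u \<bullet> v)))"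

quotient_type (overloaded) 'v clifford = "'v::euclidean_space clifford_expr" / clifford_eq
proof (intro equivpI reflpI sympI transpI)
  fix a b c :: "'v clifford_expr"
  show "clifford_eq a a" by (rule ce_refl)
  show "clifford_eq b a" if "clifford_eq a b" using that by (rule ce_sym)
  show "clifford_eq a c" if "clifford_eq a b" "clifford_eq b c" using that by (rule ce_trans)
qed

lemma Mul_one_right: "clifford_eq (Mul a (Scal 1)) a"
  by (rule ce_trans[OF ce_sym[OF Scal_central] Mul_one])

text \<open>
  Nontriviality of the quotient, by means of the representation on functions on sets of
  natural numbers in which the \<open>i\<close>-th basis vector acts by adding or removing \<open>i\<close>, up to the sign
  \<open>(-1) ^ k\<close>, with \<open>k\<close> the number of elements below \<open>i\<close>.
\<close>

definition basis_index :: "'v::euclidean_space \<Rightarrow> nat" where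
  "basis_index = (SOME f. inj_on f Basis)"

lemma inj_on_basis_index: "inj_on basis_index (Basis :: 'v::euclidean_space set)"
proof -
  have "\<exists>f :: 'v \<Rightarrow> nat. inj_on f Basis"
    using finite_imp_inj_to_nat_seg[OF finite_Basis] by blast
  then show ?thesis
    unfolding basis_index_def by (rule someI_ex)
qed

definition flip :: "nat \<Rightarrow> (nat set \<Rightarrow> real) \<Rightarrow> nat set \<Rightarrow> real" where
  "flip i f S = (-1) ^ card (S \<inter> {..<i}) * f (if i \<in> S then S - {i} else insert i S)"

lemma flip_flip: "flip i (flip i f) = f"
proof
  fix S
  have [simp]: "(S - {i}) \<inter> {..<i} = S \<inter> {..<i}" "insert i S \<inter> {..<i} = S \<inter> {..<i}" by auto
  show "flip i (flip i f) S = f S"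
    by (auto simp: flip_def insert_absorb minus_one_power_iff)
qed

lemma flip_anticommute_less: assumes "i < j" shows "flip i (flip j f) S = - flip j (flip i f) S"
proof -
  let ?x = "\<lambda>k S. if k \<in> S then S - {k} else insert k S"
  have fl: "flip k g T = (-1) ^ card (T \<inter> {..<k}) * g (?x k T)" for k g T by (simp add: flip_def)
  have comm: "?x j (?x i S) = ?x i (?x j S)" using assms by auto
  have 1: "?x j S \<inter> {..<i} = S \<inter> {..<i}" using assms by auto
  have 2: "(-1::real) ^ card (?x i S \<inter> {..<j}) = - ((-1) ^ card (S \<inter> {..<j}))"
  proof (cases "i \<in> S")
    case True
    then have "S \<inter> {..<j} = insert i ((S - {i}) \<inter> {..<j})" using assms by auto
    then have "card (S \<inter> {..<j}) = Suc (card ((S - {i}) \<inter> {..<j}))"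
      by (metis (no_types, lifting) DiffD2 IntD1 card_insert_disjoint finite_Int finite_lessThan insertI1)
    then show ?thesis using True by simp
  next
    case False
    then have "insert i S \<inter> {..<j} = insert i (S \<inter> {..<j})" using assms by auto
    then show ?thesis using False by simp
  qed
  have "flip i (flip j f) S
      = (-1) ^ card (S \<inter> {..<i}) * ((-1) ^ card (?x i S \<inter> {..<j}) * f (?x j (?x i S)))"
    by (simp only: fl)
  also have "\<dots> = - ((-1) ^ card (S \<inter> {..<j}) * ((-1) ^ card (?x j S \<inter> {..<i}) * f (?x i (?x j S))))"
    unfolding 1 2 comm by simp
  also have "\<dots> = - flip j (flip i f) S"
    by (simp only: fl)
  finally show ?thesis .
qed

lemma flip_anticommute: "i \<noteq> j \<Longrightarrow> flip i (flip j f) S + flip j (flip i f) S = 0"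
  using flip_anticommute_less[of i j f S] flip_anticommute_less[of j i f S]
  by (cases "i < j") linarith+

definition vec_op :: "'v::euclidean_space \<Rightarrow> (nat set \<Rightarrow> real) \<Rightarrow> nat set \<Rightarrow> real" where
  "vec_op v f S = (\<Sum>b\<in>Basis. (v \<bullet> b) * flip (basis_index b) f S)"

fun expr_op :: "'v::euclidean_space clifford_expr \<Rightarrow> (nat set \<Rightarrow> real) \<Rightarrow> nat set \<Rightarrow> real" where
  "expr_op (Vec v) = vec_op v"
| "expr_op (Scal r) = (\<lambda>f S. r * f S)"
| "expr_op (Add a b) = (\<lambda>f S. expr_op a f S + expr_op b f S)"
| "expr_op (Mul a b) = (\<lambda>f. expr_op a (expr_op b f))"

lemma flip_add: "flip i (\<lambda>S. f S + g S) S = flip i f S + flip i g S"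
  and flip_scale: "flip i (\<lambda>S. r * f S) S = r * flip i f S"
  by (auto simp: flip_def algebra_simps)

lemma flip_sum: "flip i (\<lambda>S. \<Sum>b\<in>B. r b * f b S) S = (\<Sum>b\<in>B. r b * flip i (f b) S)"
  by (simp add: flip_def sum_distrib_left mult.left_commute)

lemma expr_op_add: "expr_op a (\<lambda>S. f S + g S) = (\<lambda>S. expr_op a f S + expr_op a g S)"
proof (induction a arbitrary: f g)
  case (Vec v)
  then show ?case
    by (auto simp: vec_op_def flip_add distrib_left sum.distrib)
qed (auto simp: distrib_left)

lemma expr_op_scale: "expr_op a (\<lambda>S. r * f S) = (\<lambda>S. r * expr_op a f S)"
proof (induction a arbitrary: f)
  case (Vec v)
  then show ?case
    by (auto simp: vec_op_def flip_scale sum_distrib_left mult.left_commute)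
qed (auto simp: distrib_left mult.left_commute)

lemma vec_op_vec_op:
  "vec_op u (vec_op v f) S
    = (\<Sum>b\<in>Basis. \<Sum>b'\<in>Basis. (u \<bullet> b) * (v \<bullet> b') * flip (basis_index b) (flip (basis_index b') f) S)"
proof -
  have "flip i (vec_op v f) S = (\<Sum>b'\<in>Basis. (v \<bullet> b') * flip i (flip (basis_index b') f) S)" for i
    unfolding vec_op_def[abs_def] by (rule flip_sum)
  then show ?thesis
    by (simp add: vec_op_def[of u] sum_distrib_left mult.assoc)
qed

lemma vec_op_clifford: "vec_op u (vec_op v f) S + vec_op v (vec_op u f) S = 2 * (u \<bullet> v) * f S"
  for u v :: "'v::euclidean_space"
proof -
  let ?F = "\<lambda>b b'. flip (basis_index b) (flip (basis_index b') f) S"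
  have F: "?F b b' + ?F b' b = (if b' = b then 2 * f S else 0)"
    if "b \<in> Basis" "b' \<in> Basis" for b b' :: 'v
    using that inj_on_basis_index[where 'v='v] by (auto simp: flip_flip flip_anticommute inj_on_eq_iff)
  have "vec_op v (vec_op u f) S = (\<Sum>b\<in>Basis. \<Sum>b'\<in>Basis. (u \<bullet> b) * (v \<bullet> b') * ?F b' b)"
    unfolding vec_op_vec_op by (subst sum.swap) (simp add: mult_ac)
  then have "vec_op u (vec_op v f) S + vec_op v (vec_op u f) S
      = (\<Sum>b\<in>Basis. \<Sum>b'\<in>Basis. (u \<bullet> b) * (v \<bullet> b') * (?F b b' + ?F b' b))"
    by (simp add: vec_op_vec_op[of u v] sum.distrib distrib_left)
  also have "\<dots> = (\<Sum>b\<in>Basis. \<Sum>b'\<in>Basis. (if b' = b then (u \<bullet> b) * (v \<bullet> b') * (2 * f S) else 0))"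
    by (intro sum.cong refl) (simp add: F)
  also have "\<dots> = 2 * (u \<bullet> v) * f S"
    by (simp add: euclidean_inner[of u v] sum_distrib_left sum_distrib_right mult_ac)
  finally show ?thesis .
qed

lemma expr_op_cong: "clifford_eq a b \<Longrightarrow> expr_op a = expr_op b"
proof (induction rule: clifford_eq.induct)
  case (Clifford u v)
  then show ?case by (auto simp: vec_op_clifford)
next
  case (Vec_add u v)
  then show ?case by (auto simp: vec_op_def fun_eq_iff inner_add_left distrib_right sum.distrib)
next
  case (Vec_scale r v)
  then show ?case by (auto simp: vec_op_def fun_eq_iff sum_distrib_left mult.assoc)
qed (auto simp: expr_op_add expr_op_scale algebra_simps)

instantiation clifford :: (euclidean_space) real_algebra_1
begin

lift_definition zero_clifford :: "'a clifford" is "Scal 0" .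
lift_definition one_clifford :: "'a clifford" is "Scal 1" .
lift_definition plus_clifford :: "'a clifford \<Rightarrow> 'a clifford \<Rightarrow> 'a clifford" is Add
  by (rule Add_cong)
lift_definition times_clifford :: "'a clifford \<Rightarrow> 'a clifford \<Rightarrow> 'a clifford" is Mul
  by (rule Mul_cong)
lift_definition uminus_clifford :: "'a clifford \<Rightarrow> 'a clifford" is "Mul (Scal (-1))"
  by (intro Mul_cong ce_refl)
lift_definition minus_clifford :: "'a clifford \<Rightarrow> 'a clifford \<Rightarrow> 'a clifford"
  is "\<lambda>a b. Add a (Mul (Scal (-1)) b)"
  by (intro Add_cong Mul_cong ce_refl)
lift_definition scaleR_clifford :: "real \<Rightarrow> 'a clifford \<Rightarrow> 'a clifford" is "\<lambda>r. Mul (Scal r)"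
  by (intro Mul_cong ce_refl)

instance
proof
  fix a b c :: "'a clifford" and r s :: real
  show "a + b + c = a + (b + c)" by transfer (rule Add_assoc)
  show "a + b = b + a" by transfer (rule Add_commute)
  show "0 + a = a" by transfer (rule Add_zero)
  show "- a + a = 0" by transfer (rule Add_minus)
  show "a - b = a + - b" by transfer (rule ce_refl)
  show "a * b * c = a * (b * c)" by transfer (rule Mul_assoc)
  show "(a + b) * c = a * c + b * c" by transfer (rule Add_Mul)
  show "a * (b + c) = a * b + a * c" by transfer (rule Mul_Add)
  show "1 * a = a" by transfer (rule Mul_one)
  show "a * 1 = a" by transfer (rule Mul_one_right)
  show "r *\<^sub>R (a + b) = r *\<^sub>R a + r *\<^sub>R b" by transfer (rule Mul_Add)
  show "(r + s) *\<^sub>R a = r *\<^sub>R a + s *\<^sub>R a"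
    by transfer (rule ce_trans[OF Mul_cong[OF Scal_add ce_refl] Add_Mul])
  show "r *\<^sub>R s *\<^sub>R a = (r * s) *\<^sub>R a"
    by transfer (rule ce_sym[OF ce_trans[OF Mul_cong[OF Scal_mult ce_refl] Mul_assoc]])
  show "1 *\<^sub>R a = a" by transfer (rule Mul_one)
  show "r *\<^sub>R a * b = r *\<^sub>R (a * b)" by transfer (rule Mul_assoc)
  show "a * r *\<^sub>R b = r *\<^sub>R (a * b)"
    by transfer
      (rule ce_trans[OF ce_sym[OF Mul_assoc]
         ce_trans[OF Mul_cong[OF ce_sym[OF Scal_central] ce_refl] Mul_assoc]])
  show "(0 :: 'a clifford) \<noteq> 1"
  proof transfer
    have "expr_op (Scal 0 :: 'a clifford_expr) (\<lambda>_. 1) {} \<noteq> expr_op (Scal 1 :: 'a clifford_expr) (\<lambda>_. 1) {}"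
      by simp
    then show "\<not> clifford_eq (Scal 0 :: 'a clifford_expr) (Scal 1)"
      using expr_op_cong by metis
  qed
qed

end

lift_definition cvec :: "'v::euclidean_space \<Rightarrow> 'v clifford" is Vec .

lemma cvec_clifford: "cvec u * cvec v + cvec v * cvec u = of_real (2 * (u \<bullet> v))"
  unfolding of_real_def by transfer (rule ce_trans[OF Clifford ce_sym[OF Mul_one_right]])

primrec expr_eps :: "'v::euclidean_space clifford_expr \<Rightarrow> 'v clifford_expr" where
  "expr_eps (Vec v) = Vec (- v)"
| "expr_eps (Scal r) = Scal r"
| "expr_eps (Add a b) = Add (expr_eps a) (expr_eps b)"
| "expr_eps (Mul a b) = Mul (expr_eps a) (expr_eps b)"

lemma expr_eps_cong: "clifford_eq a b \<Longrightarrow> clifford_eq (expr_eps a) (expr_eps b)"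
proof (induction rule: clifford_eq.induct)
  case (Vec_add u v)
  then show ?case using clifford_eq.Vec_add[of "- u" "- v"] by simp
next
  case (Vec_scale r v)
  then show ?case using clifford_eq.Vec_scale[of r "- v"] by simp
next
  case (Clifford u v)
  then show ?case using clifford_eq.Clifford[of "- u" "- v"] by simp
next
  case (ce_sym a b)
  show ?case by (rule clifford_eq.ce_sym[OF ce_sym.IH])
next
  case (ce_trans a b c)
  show ?case by (rule clifford_eq.ce_trans[OF ce_trans.IH])
qed (simp_all add: clifford_eq.ce_refl Add_cong Mul_cong Add_assoc Add_commute Add_zero Add_minus
    Mul_assoc Mul_one Mul_Add Add_Mul Scal_add Scal_mult Scal_central)

primrec expr_transp :: "'v::euclidean_space clifford_expr \<Rightarrow> 'v clifford_expr" where
  "expr_transp (Vec v) = Vec v"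
| "expr_transp (Scal r) = Scal r"
| "expr_transp (Add a b) = Add (expr_transp a) (expr_transp b)"
| "expr_transp (Mul a b) = Mul (expr_transp b) (expr_transp a)"

lemma expr_transp_cong: "clifford_eq a b \<Longrightarrow> clifford_eq (expr_transp a) (expr_transp b)"
proof (induction rule: clifford_eq.induct)
  case (Clifford u v)
  show ?case unfolding expr_transp.simps by (rule ce_trans[OF Add_commute clifford_eq.Clifford])
next
  case (Scal_mult r s)
  then show ?case using clifford_eq.Scal_mult[of s r] by (simp add: mult.commute)
next
  case (ce_sym a b)
  show ?case by (rule clifford_eq.ce_sym[OF ce_sym.IH])
next
  case (ce_trans a b c)
  show ?case by (rule clifford_eq.ce_trans[OF ce_trans.IH])
next
  case (Mul_assoc a b c)
  show ?case unfolding expr_transp.simps by (rule clifford_eq.ce_sym[OF clifford_eq.Mul_assoc])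
next
  case (Add_minus a)
  have "clifford_eq (Add (Mul (expr_transp a) (Scal (-1))) (expr_transp a))
      (Add (Mul (Scal (-1)) (expr_transp a)) (expr_transp a))"
    by (intro Add_cong ce_refl clifford_eq.ce_sym[OF Scal_central])
  then show ?case unfolding expr_transp.simps by (rule clifford_eq.ce_trans[OF _ clifford_eq.Add_minus])
next
  case (Scal_central r a)
  show ?case unfolding expr_transp.simps by (rule clifford_eq.ce_sym[OF clifford_eq.Scal_central])
next
  case (Vec_scale r v)
  show ?case unfolding expr_transp.simps
    by (rule clifford_eq.ce_trans[OF clifford_eq.Vec_scale Scal_central])
qed (simp_all add: ce_refl Add_cong Mul_cong Add_assoc Add_commute Add_zero Mul_one_right
    Mul_Add Add_Mul Scal_add Vec_add)

lift_definition cliff_eps :: "'v::euclidean_space clifford \<Rightarrow> 'v clifford" is expr_eps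
  by (rule expr_eps_cong)

lift_definition cliff_transp :: "'v::euclidean_space clifford \<Rightarrow> 'v clifford" is expr_transp
  by (rule expr_transp_cong)

definition cliff_star :: "'v::euclidean_space clifford \<Rightarrow> 'v clifford" where
  "cliff_star \<eta> = cliff_eps (cliff_transp \<eta>)"


section \<open>The Pin group and the double cover\<close>

definition cliff_invertible :: "'v::euclidean_space clifford \<Rightarrow> bool" where
  "cliff_invertible \<eta> \<longleftrightarrow> (\<exists>\<zeta>. \<eta> * \<zeta> = 1 \<and> \<zeta> * \<eta> = 1)"

definition cliff_inv :: "'v::euclidean_space clifford \<Rightarrow> 'v clifford" where
  "cliff_inv \<eta> = (THE \<zeta>. \<eta> * \<zeta> = 1 \<and> \<zeta> * \<eta> = 1)"

definition Pin :: "'v::euclidean_space clifford set" where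
  "Pin = {\<eta>. cliff_invertible \<eta>
            \<and> (\<forall>y. cliff_eps \<eta> * cvec y * cliff_inv \<eta> \<in> range cvec)
            \<and> (cliff_star \<eta> * \<eta>)\<^sup>2 = 1}"

definition pin_proj :: "'v::euclidean_space clifford \<Rightarrow> 'v \<Rightarrow> 'v" where
  "pin_proj \<eta> y = (THE x. cvec x = cliff_eps \<eta> * cvec y * cliff_inv \<eta>)"


section \<open>Root systems and reflection groups\<close>

text \<open>The dual space \<open>E\<^sup>*\<close> is the type of (bounded) linear functionals.\<close>

type_synonym 'v dual = "'v \<Rightarrow>\<^sub>L real"

text \<open>
  The coroot map \<open>\<alpha> \<mapsto> \<alpha>\<^sup>\<or>\<close> is an argument \<open>cor\<close>. Roots need be neither crystallographic nor span the
  dual space.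
\<close>

definition reflection :: "('v::euclidean_space dual \<Rightarrow> 'v) \<Rightarrow> 'v dual \<Rightarrow> 'v \<Rightarrow> 'v" where
  "reflection cor \<alpha> y = y - blinfun_apply \<alpha> y *\<^sub>R cor \<alpha>"

text \<open>
  The functional \<open>\<beta> - \<langle>\<beta>, \<alpha>\<^sup>\<or>\<rangle> \<alpha>\<close> below is the image of \<open>\<beta>\<close> under the action of \<open>s\<^sub>\<alpha>\<close> on the dual space.
  Orthogonality of \<open>s\<^sub>\<alpha>\<close> and \<open>\<langle>\<alpha>, \<alpha>\<^sup>\<or>\<rangle> = 2\<close> determine \<open>\<alpha>\<^sup>\<or>\<close>, so the coroots automatically form the
  dual root system.
\<close>

definition root_system :: "'v::euclidean_space dual set \<Rightarrow> ('v dual \<Rightarrow> 'v) \<Rightarrow> bool" where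
  "root_system R cor \<longleftrightarrow>
     finite R
   \<and> (\<forall>\<alpha>\<in>R. blinfun_apply \<alpha> (cor \<alpha>) = 2)
   \<and> (\<forall>\<alpha>\<in>R. orthogonal_transformation (reflection cor \<alpha>))
   \<and> (\<forall>\<alpha>\<in>R. \<forall>\<beta>\<in>R. \<beta> - blinfun_apply \<beta> (cor \<alpha>) *\<^sub>R \<alpha> \<in> R)
   \<and> (\<forall>\<alpha>\<in>R. \<forall>t. t *\<^sub>R \<alpha> \<in> R \<longrightarrow> t = 1 \<or> t = -1)"

definition orthogonal_group :: "('v::euclidean_space \<Rightarrow> 'v) monoid" where
  "orthogonal_group = \<lparr>carrier = {f. orthogonal_transformation f}, mult = (\<circ>), one = id\<rparr>"

definition refl_group :: "'v::euclidean_space dual set \<Rightarrow> ('v dual \<Rightarrow> 'v) \<Rightarrow> ('v \<Rightarrow> 'v) set" where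
  "refl_group R cor = generate orthogonal_group (reflection cor ` R)"

text \<open>A positive system consists of the roots which are positive on some regular vector.\<close>

definition positive_system :: "'v::euclidean_space dual set \<Rightarrow> 'v dual set \<Rightarrow> bool" where
  "positive_system R Rp \<longleftrightarrow>
     (\<exists>x. (\<forall>\<alpha>\<in>R. blinfun_apply \<alpha> x \<noteq> 0) \<and> Rp = {\<alpha>\<in>R. blinfun_apply \<alpha> x > 0})"

definition simple_roots :: "'v::euclidean_space dual set \<Rightarrow> 'v dual set \<Rightarrow> bool" where
  "simple_roots Rp \<Delta> \<longleftrightarrow>
     \<Delta> \<subseteq> Rp \<and> independent \<Delta>
   \<and> (\<forall>\<alpha>\<in>Rp. \<exists>a. (\<forall>\<delta>\<in>\<Delta>. a \<delta> \<ge> 0) \<and> \<alpha> = (\<Sum>\<delta>\<in>\<Delta>. a \<delta> *\<^sub>R \<delta>))"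

definition refl_length ::
    "('v::euclidean_space dual \<Rightarrow> 'v) \<Rightarrow> 'v dual set \<Rightarrow> ('v \<Rightarrow> 'v) \<Rightarrow> nat" where
  "refl_length cor \<Delta> w =
     (LEAST k. \<exists>ds. length ds = k \<and> set ds \<subseteq> \<Delta> \<and> w = foldr (\<circ>) (map (reflection cor) ds) id)"

definition longest_element ::
    "'v::euclidean_space dual set \<Rightarrow> ('v dual \<Rightarrow> 'v) \<Rightarrow> 'v dual set \<Rightarrow> ('v \<Rightarrow> 'v) \<Rightarrow> bool" where
  "longest_element R cor \<Delta> w0 \<longleftrightarrow>
     w0 \<in> refl_group R cor
   \<and> (\<forall>w\<in>refl_group R cor. refl_length cor \<Delta> w \<le> refl_length cor \<Delta> w0)"

text \<open>In the following definition, \<open>\<beta> \<circ> w = \<alpha>\<close> says that \<open>\<beta>\<close> is the image of \<open>\<alpha>\<close> under \<open>w\<close>.\<close>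

definition invariant_parameter ::
    "'v::euclidean_space dual set \<Rightarrow> ('v dual \<Rightarrow> 'v) \<Rightarrow> 'v dual set \<Rightarrow> ('v dual \<Rightarrow> complex) \<Rightarrow> bool" where
  "invariant_parameter R cor Rp c \<longleftrightarrow>
     (\<forall>\<alpha>\<in>Rp. \<forall>\<beta>\<in>Rp. \<forall>w\<in>refl_group R cor.
        (\<forall>y. blinfun_apply \<beta> (w y) = blinfun_apply \<alpha> y) \<longrightarrow> c \<beta> = c \<alpha>)"

definition W_tilde ::
    "'v::euclidean_space dual set \<Rightarrow> ('v dual \<Rightarrow> 'v) \<Rightarrow> 'v clifford monoid" where
  "W_tilde R cor =
     \<lparr>carrier = {\<eta> \<in> Pin. pin_proj \<eta> \<in> refl_group R cor}, mult = (*), one = 1\<rparr>"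

definition s_tilde :: "('v::euclidean_space dual \<Rightarrow> 'v) \<Rightarrow> 'v dual \<Rightarrow> 'v clifford" where
  "s_tilde cor \<alpha> = inverse (norm (cor \<alpha>)) *\<^sub>R cvec (cor \<alpha>)"


section \<open>Group algebras and admissible elements\<close>

text \<open>
  Elements are formal finite combinations of group elements. In the group algebra of \<open>W_tilde\<close> the
  Clifford element \<open>\<theta> = - 1\<close> is thus a basis element, different from the scalar \<open>-1\<close>.
\<close>

definition group_algebra :: "('g, 'm) monoid_scheme \<Rightarrow> ('g \<Rightarrow>\<^sub>0 complex) ring" where
  "group_algebra G =
     \<lparr>carrier = {f. Poly_Mapping.keys f \<subseteq> carrier G},
      mult = (\<lambda>f g. \<Sum>a\<in>Poly_Mapping.keys f. \<Sum>b\<in>Poly_Mapping.keys g.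
                Poly_Mapping.single (a \<otimes>\<^bsub>G\<^esub> b) (Poly_Mapping.lookup f a * Poly_Mapping.lookup g b)),
      one = Poly_Mapping.single \<one>\<^bsub>G\<^esub> 1,
      zero = 0,
      add = (+)\<rparr>"

definition linear_extension :: "('g \<Rightarrow> 'h) \<Rightarrow> ('g \<Rightarrow>\<^sub>0 complex) \<Rightarrow> ('h \<Rightarrow>\<^sub>0 complex)" where
  "linear_extension h f =
     (\<Sum>a\<in>Poly_Mapping.keys f. Poly_Mapping.single (h a) (Poly_Mapping.lookup f a))"

definition antilinear_extension :: "('g \<Rightarrow> 'h) \<Rightarrow> ('g \<Rightarrow>\<^sub>0 complex) \<Rightarrow> ('h \<Rightarrow>\<^sub>0 complex)" where
  "antilinear_extension h f =
     (\<Sum>a\<in>Poly_Mapping.keys f. Poly_Mapping.single (h a) (cnj (Poly_Mapping.lookup f a)))"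

definition central :: "('a, 'm) ring_scheme \<Rightarrow> 'a \<Rightarrow> bool" where
  "central A z \<longleftrightarrow> z \<in> carrier A \<and> (\<forall>x\<in>carrier A. z \<otimes>\<^bsub>A\<^esub> x = x \<otimes>\<^bsub>A\<^esub> z)"

text \<open>Here \<open>st\<close> is the star operation on the elements of the group \<open>G\<close>.\<close>

definition admissible :: "('g, 'm) monoid_scheme \<Rightarrow> ('g \<Rightarrow> 'g) \<Rightarrow> ('g \<Rightarrow>\<^sub>0 complex) \<Rightarrow> bool" where
  "admissible G st C \<longleftrightarrow> central (group_algebra G) C \<and> antilinear_extension st C = C"

text \<open>
  The cyclic group of order two is \<open>integer_mod_group 2\<close>; its generator \<open>1\<close> is the element
  denoted by \<open>(-1)\<close> in the product with \<open>W_tilde\<close>. The star operation fixes both of its elements.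
\<close>

definition W_tilde_C2 ::
    "'v::euclidean_space dual set \<Rightarrow> ('v dual \<Rightarrow> 'v) \<Rightarrow> ('v clifford \<times> int) monoid" where
  "W_tilde_C2 R cor = W_tilde R cor \<times>\<times> integer_mod_group 2"

definition star_C2 :: "'v::euclidean_space clifford \<times> int \<Rightarrow> 'v clifford \<times> int" where
  "star_C2 = map_prod cliff_star id"

definition embed_C2 :: "('v::euclidean_space clifford \<Rightarrow>\<^sub>0 complex) \<Rightarrow> ('v clifford \<times> int \<Rightarrow>\<^sub>0 complex)" where
  "embed_C2 = linear_extension (\<lambda>\<eta>. (\<eta>, \<one>\<^bsub>integer_mod_group 2\<^esub>))"

definition hat_admissible ::
    "'v::euclidean_space dual set \<Rightarrow> ('v dual \<Rightarrow> 'v) \<Rightarrow> ('v \<Rightarrow> 'v) \<Rightarrow> ('v clifford \<Rightarrow>\<^sub>0 complex) \<Rightarrow> bool" where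
  "hat_admissible R cor w0 C \<longleftrightarrow>
     (if w0 = uminus then admissible (W_tilde_C2 R cor) star_C2 (embed_C2 C)
      else admissible (W_tilde R cor) cliff_star C)"

definition C2_element ::
    "'v::euclidean_space dual set \<Rightarrow> ('v dual \<Rightarrow> 'v) \<Rightarrow> 'v dual set \<Rightarrow> ('v dual \<Rightarrow> complex)
      \<Rightarrow> ('v clifford \<Rightarrow>\<^sub>0 complex)" where
  "C2_element R cor Rp c =
     (\<Sum>\<alpha>\<in>Rp. \<Sum>\<beta>\<in>Rp.
        Poly_Mapping.single (s_tilde cor \<alpha> \<otimes>\<^bsub>W_tilde R cor\<^esub> s_tilde cor \<beta>) (1 / 4 * c \<alpha> * c \<beta>))"

end

theory Submission
  imports Defs
begin

text \<open>
  Write \<open>T\<close> for the sum of the \<open>c\<^sub>\<alpha> s\<^sub>\<alpha>\<close> over the positive roots (with \<open>s\<^sub>\<alpha>\<close> the element of the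
  double cover), so that the element in question is \<open>T\<^sup>2 / 4\<close>. In the Clifford algebra
  \<open>s\<^sub>\<gamma> s\<^sub>\<alpha> s\<^sub>\<gamma> = - s\<^sub>\<beta>\<close> with \<open>\<beta>\<close> the reflection of \<open>\<alpha>\<close> in \<open>\<gamma>\<close>. A simple reflection permutes the positive
  roots other than \<open>\<delta>\<close>, so conjugation by \<open>s\<^sub>\<delta>\<close> maps \<open>T = T' + c\<^sub>\<delta> s\<^sub>\<delta>\<close> to \<open>\<theta> T' + c\<^sub>\<delta> s\<^sub>\<delta>\<close>. It fixes \<open>T\<^sup>2\<close>:
  as \<open>\<theta>\<^sup>2 = 1\<close>, the squares are preserved, and conjugation swaps the two mixed terms \<open>T' s\<^sub>\<delta>\<close> and
  \<open>s\<^sub>\<delta> T'\<close>. Reflections in simple roots generate everything up to \<open>\<theta>\<close>, because the kernel of the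
  projection from the Pin group is \<open>{1, -1}\<close>.
\<close>

section \<open>Formal linear combinations\<close>

lemma sum_keys_superset:
  assumes "finite A" "Poly_Mapping.keys f \<subseteq> A" "\<And>a. F a 0 = 0"
  shows "(\<Sum>a\<in>Poly_Mapping.keys f. F a (Poly_Mapping.lookup f a)) = (\<Sum>a\<in>A. F a (Poly_Mapping.lookup f a))"
  using assms by (intro sum.mono_neutral_left) (auto simp: in_keys_iff)

text \<open>Cancellation can make the support of \<open>f + g\<close> smaller than the union of the
  two supports. All three sums are therefore extended to that union, where the added terms are
  zero.\<close>

lemma sum_keys_add:
  fixes F :: "'a \<Rightarrow> 'b::comm_monoid_add \<Rightarrow> 'c::comm_monoid_add"
  assumes "\<And>a. F a 0 = 0" "\<And>a x y. F a (x + y) = F a x + F a y"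
  shows "(\<Sum>a\<in>Poly_Mapping.keys (f + g). F a (Poly_Mapping.lookup (f + g) a))
    = (\<Sum>a\<in>Poly_Mapping.keys f. F a (Poly_Mapping.lookup f a))
      + (\<Sum>a\<in>Poly_Mapping.keys g. F a (Poly_Mapping.lookup g a))"
proof -
  let ?A = "Poly_Mapping.keys f \<union> Poly_Mapping.keys g"
  have "Poly_Mapping.keys (f + g) \<subseteq> ?A" by (rule Poly_Mapping.keys_add)
  then show ?thesis
    using assms(2)
      sum_keys_superset[of ?A "f + g" F, OF _ _ assms(1)]
      sum_keys_superset[of ?A f F, OF _ _ assms(1)]
      sum_keys_superset[of ?A g F, OF _ _ assms(1)]
    by (simp add: lookup_add sum.distrib)
qed

lemma linear_extension_add:
  "linear_extension h (f + g) = linear_extension h f + linear_extension h g"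
  unfolding linear_extension_def by (rule sum_keys_add) (simp_all add: single_add)

lemma linear_extension_single [simp]:
  "linear_extension h (Poly_Mapping.single a r) = Poly_Mapping.single (h a) r"
  by (cases "r = 0") (simp_all add: linear_extension_def)

lemma linear_extension_sum:
  "linear_extension h (\<Sum>i\<in>I. f i) = (\<Sum>i\<in>I. linear_extension h (f i))"
proof -
  have "linear_extension h 0 = 0" by (simp add: linear_extension_def)
  then show ?thesis
    by (induction I rule: infinite_finite_induct) (simp_all add: linear_extension_add)
qed

lemma linear_extension_comp:
  "linear_extension h (linear_extension k f) = linear_extension (\<lambda>x. h (k x)) f"
  by (simp add: linear_extension_def[of k] linear_extension_sum) (simp add: linear_extension_def)

lemma antilinear_extension_add:
  "antilinear_extension h (f + g) = antilinear_extension h f + antilinear_extension h g"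
  unfolding antilinear_extension_def by (rule sum_keys_add) (simp_all add: single_add)

lemma antilinear_extension_single [simp]:
  "antilinear_extension h (Poly_Mapping.single a r) = Poly_Mapping.single (h a) (cnj r)"
  by (cases "r = 0") (simp_all add: antilinear_extension_def)

lemma antilinear_extension_sum:
  "antilinear_extension h (\<Sum>i\<in>I. f i) = (\<Sum>i\<in>I. antilinear_extension h (f i))"
proof -
  have "antilinear_extension h 0 = 0" by (simp add: antilinear_extension_def)
  then show ?thesis
    by (induction I rule: infinite_finite_induct) (simp_all add: antilinear_extension_add)
qed

lemma antilinear_extension_linear_extension:
  "antilinear_extension h (linear_extension k f) = antilinear_extension (\<lambda>x. h (k x)) f"
  by (simp add: linear_extension_def[of k] antilinear_extension_sum) (simp add: antilinear_extension_def)

lemma linear_extension_antilinear_extension: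
  "linear_extension h (antilinear_extension k f) = antilinear_extension (\<lambda>x. h (k x)) f"
  by (simp add: antilinear_extension_def[of k] linear_extension_sum) (simp add: antilinear_extension_def)

lemma keys_linear_extension: "Poly_Mapping.keys (linear_extension h f) \<subseteq> h ` Poly_Mapping.keys f"
  unfolding linear_extension_def by (rule order_trans[OF keys_sum]) (auto split: if_splits)

section \<open>Commutation with group elements\<close>

text \<open>By bilinearity it suffices to test against group elements. Multiplying \<open>C\<close>
  by one of them is the pushforward of \<open>C\<close> along a translation, so no convolution
  product remains in \<open>comm\<close>.\<close>

lemma central_group_algebra:
  assumes keys: "Poly_Mapping.keys C \<subseteq> carrier G"
    and comm: "\<And>g. g \<in> carrier G \<Longrightarrow>
      linear_extension (\<lambda>x. x \<otimes>\<^bsub>G\<^esub> g) C = linear_extension (\<lambda>x. g \<otimes>\<^bsub>G\<^esub> x) C"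
  shows "central (group_algebra G) C"
proof -
  have "C \<otimes>\<^bsub>group_algebra G\<^esub> x = x \<otimes>\<^bsub>group_algebra G\<^esub> C" if x: "Poly_Mapping.keys x \<subseteq> carrier G" for x
  proof -
    \<comment> \<open>Coefficientwise the scalar \<open>r\<close> splits off as a factor; this lets
      \<open>comm\<close>, which has no scalar, act on each term of \<open>x\<close>.\<close>
    have lookup: "Poly_Mapping.lookup
        (\<Sum>a\<in>Poly_Mapping.keys C. Poly_Mapping.single (h a) (Poly_Mapping.lookup C a * r)) k
        = Poly_Mapping.lookup (linear_extension h C) k * r" for h :: "'a \<Rightarrow> 'a" and r k
      unfolding linear_extension_def lookup_sum sum_distrib_right
      by (intro sum.cong refl) (simp add: lookup_single when_def)
    have swap: "(\<Sum>a\<in>Poly_Mapping.keys C. Poly_Mapping.single (a \<otimes>\<^bsub>G\<^esub> b) (Poly_Mapping.lookup C a * r))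
        = (\<Sum>a\<in>Poly_Mapping.keys C. Poly_Mapping.single (b \<otimes>\<^bsub>G\<^esub> a) (Poly_Mapping.lookup C a * r))"
      if "b \<in> carrier G" for b r
      by (rule poly_mapping_eqI) (simp only: lookup comm[OF that])
    have "C \<otimes>\<^bsub>group_algebra G\<^esub> x = (\<Sum>b\<in>Poly_Mapping.keys x. \<Sum>a\<in>Poly_Mapping.keys C.
        Poly_Mapping.single (a \<otimes>\<^bsub>G\<^esub> b) (Poly_Mapping.lookup C a * Poly_Mapping.lookup x b))"
      unfolding group_algebra_def by (simp, rule sum.swap)
    also have "\<dots> = (\<Sum>b\<in>Poly_Mapping.keys x. \<Sum>a\<in>Poly_Mapping.keys C.
        Poly_Mapping.single (b \<otimes>\<^bsub>G\<^esub> a) (Poly_Mapping.lookup C a * Poly_Mapping.lookup x b))"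
      using x by (intro sum.cong refl swap) auto
    also have "\<dots> = x \<otimes>\<^bsub>group_algebra G\<^esub> C"
      by (simp add: group_algebra_def mult.commute)
    finally show ?thesis .
  qed
  with keys show ?thesis by (simp add: central_def group_algebra_def)
qed

text \<open>Commutation with the basis element \<open>g\<close>, formulated with the ring product so
  that no membership of \<open>g\<close> in a group has to be carried along.\<close>

definition commutes :: "('a::ring_1 \<Rightarrow>\<^sub>0 complex) \<Rightarrow> 'a \<Rightarrow> bool" where
  "commutes C g \<longleftrightarrow> linear_extension (\<lambda>x. x * g) C = linear_extension (\<lambda>x. g * x) C"

lemma commutes_mult:
  assumes "commutes C g" "commutes C h"
  shows "commutes C (g * h)"
proof -
  have "linear_extension (\<lambda>x. x * (g * h)) C = linear_extension (\<lambda>x. x * h) (linear_extension (\<lambda>x. x * g) C)"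
    by (simp add: linear_extension_comp mult.assoc)
  also have "\<dots> = linear_extension (\<lambda>x. g * x) (linear_extension (\<lambda>x. x * h) C)"
    using assms(1) by (simp add: commutes_def linear_extension_comp mult.assoc)
  also have "\<dots> = linear_extension (\<lambda>x. g * h * x) C"
    using assms(2) by (simp add: commutes_def linear_extension_comp mult.assoc)
  finally show ?thesis by (simp only: commutes_def)
qed

text \<open>The argument \<open>- 1\<close> is the group element \<theta>, not a scalar of the group
  algebra. Both translations by it send the basis element \<open>x\<close> to
  \<open>- x\<close>.\<close>

lemma commutes_one: "commutes C 1" and commutes_minus_one: "commutes C (- 1)"
  by (simp_all add: commutes_def)

text \<open>The cyclic factor is abelian and \<open>star_C2\<close> fixes it pointwise, so both
  properties transfer along the embedding with second coordinate \<open>0\<close>.\<close>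

lemma admissible_embed_C2:
  assumes keys: "Poly_Mapping.keys C \<subseteq> carrier (W_tilde R cor)"
    and comm: "\<And>g. g \<in> carrier (W_tilde R cor) \<Longrightarrow>
      linear_extension (\<lambda>x. x * g) C = linear_extension (\<lambda>x. g * x) C"
    and star: "antilinear_extension cliff_star C = C"
  shows "admissible (W_tilde_C2 R cor) star_C2 (embed_C2 C)"
proof -
  let ?\<iota> = "\<lambda>\<eta> :: 'a clifford. (\<eta>, 0 :: int)"
  have embed: "embed_C2 C = linear_extension ?\<iota> C" by (simp add: embed_C2_def)
  have "central (group_algebra (W_tilde_C2 R cor)) (embed_C2 C)"
  proof (rule central_group_algebra)
    show "Poly_Mapping.keys (embed_C2 C) \<subseteq> carrier (W_tilde_C2 R cor)"
      using keys keys_linear_extension[of ?\<iota> C]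
      by (force simp: embed W_tilde_C2_def integer_mod_group_def)
    fix gi assume "gi \<in> carrier (W_tilde_C2 R cor)"
    then obtain g i where gi: "gi = (g, i)" and g: "g \<in> carrier (W_tilde R cor)"
      by (auto simp: W_tilde_C2_def)
    \<comment> \<open>Multiplying \<open>(x, 0)\<close> by \<open>(g, i)\<close> on either side puts
      \<open>i mod 2\<close> into the second coordinate, so both products are images under the same
      map.\<close>
    let ?\<kappa> = "\<lambda>y :: 'a clifford. (y, i mod 2)"
    have "linear_extension (\<lambda>x. x \<otimes>\<^bsub>W_tilde_C2 R cor\<^esub> gi) (embed_C2 C)
        = linear_extension ?\<kappa> (linear_extension (\<lambda>x. x * g) C)"
      by (simp add: embed linear_extension_comp gi W_tilde_C2_def W_tilde_def integer_mod_group_def)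
    also have "\<dots> = linear_extension ?\<kappa> (linear_extension (\<lambda>x. g * x) C)"
      by (simp only: comm[OF g])
    also have "\<dots> = linear_extension (\<lambda>x. gi \<otimes>\<^bsub>W_tilde_C2 R cor\<^esub> x) (embed_C2 C)"
      by (simp add: embed linear_extension_comp gi W_tilde_C2_def W_tilde_def integer_mod_group_def)
    finally show "linear_extension (\<lambda>x. x \<otimes>\<^bsub>W_tilde_C2 R cor\<^esub> gi) (embed_C2 C)
        = linear_extension (\<lambda>x. gi \<otimes>\<^bsub>W_tilde_C2 R cor\<^esub> x) (embed_C2 C)" .
  qed
  moreover have "antilinear_extension star_C2 (embed_C2 C) = linear_extension ?\<iota> (antilinear_extension cliff_star C)"
    by (simp add: embed antilinear_extension_linear_extension linear_extension_antilinear_extension star_C2_def)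
  ultimately show ?thesis by (simp add: admissible_def star embed)
qed

section \<open>The Clifford algebra\<close>

lemma cvec_add: "cvec (u + v) = cvec u + cvec v"
  by transfer (rule Vec_add)

lemma cvec_scaleR: "cvec (r *\<^sub>R v) = r *\<^sub>R cvec v"
  by transfer (rule Vec_scale)

lemma cvec_zero [simp]: "cvec 0 = 0"
  using cvec_scaleR[of 0 0] by simp

lemma cvec_minus: "cvec (- v) = - cvec v"
  using cvec_scaleR[of "-1" v] by simp

lemma cvec_diff: "cvec (u - v) = cvec u - cvec v"
  using cvec_add[of u "- v"] by (simp add: cvec_minus)

lemma cvec_sum: "cvec (\<Sum>i\<in>I. f i) = (\<Sum>i\<in>I. cvec (f i))"
  by (induction I rule: infinite_finite_induct) (simp_all add: cvec_add)

lemma cvec_square: "cvec v * cvec v = of_real (v \<bullet> v)"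
proof -
  have "2 *\<^sub>R (cvec v * cvec v) = 2 *\<^sub>R of_real (v \<bullet> v)"
    using cvec_clifford[of v v] by (simp only: scaleR_2 mult_2 of_real_add)
  then show ?thesis by simp
qed

text \<open>The square of \<open>cvec (u - v)\<close> is the scalar |u - v|^2. Scalars embed into
  the algebra, and the inner product is definite.\<close>

lemma cvec_eq_iff [simp]: "cvec u = cvec v \<longleftrightarrow> u = v"
proof
  assume "cvec u = cvec v"
  then have "of_real ((u - v) \<bullet> (u - v)) = (0 :: 'a clifford)"
    by (simp flip: cvec_square add: cvec_diff)
  then show "u = v" by (simp only: of_real_eq_0_iff) simp
qed simp

text \<open>Moving \<open>n\<close> past \<open>v\<close> by the Clifford relation produces the
  scalar term, and \<open>n\<close> squares to 1. The minus sign is the source of \<theta> in the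
  conjugation rule for the lifted reflections.\<close>

lemma cvec_reflection:
  assumes "n \<bullet> n = 1"
  shows "cvec n * cvec v * cvec n = - cvec (v - (2 * (v \<bullet> n)) *\<^sub>R n)"
proof -
  have "cvec n * cvec v = of_real (2 * (n \<bullet> v)) - cvec v * cvec n"
    using cvec_clifford[of n v] by (simp add: eq_diff_eq)
  then have "cvec n * cvec v * cvec n = of_real (2 * (n \<bullet> v)) * cvec n - cvec v * (cvec n * cvec n)"
    by (simp add: left_diff_distrib mult.assoc)
  then show ?thesis
    by (simp add: cvec_square assms cvec_diff cvec_scaleR inner_commute of_real_def)
qed

text \<open>Every element is the class of an expression, so structural induction on expressions
  descends to the quotient.\<close>

lemma clifford_induct [case_names vec scal add mult]:
  assumes "\<And>v. P (cvec v)" "\<And>r. P (of_real r)"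
    "\<And>x y. P x \<Longrightarrow> P y \<Longrightarrow> P (x + y)" "\<And>x y. P x \<Longrightarrow> P y \<Longrightarrow> P (x * y)"
  shows "P z"
proof -
  have scal: "abs_clifford (Scal r) = (of_real r :: 'a clifford)" for r
    unfolding of_real_def one_clifford_def
    by (simp add: scaleR_clifford.abs_eq clifford.abs_eq_iff ce_sym[OF Mul_one_right])
  have "P (abs_clifford e)" for e
  proof (induction e)
    case (Vec v) then show ?case using assms(1)[of v] by (simp add: cvec_def)
  next
    case (Scal r) then show ?case using assms(2) by (simp add: scal)
  next
    case (Add a b) then show ?case using assms(3) by (simp flip: plus_clifford.abs_eq)
  next
    case (Mul a b) then show ?case using assms(4) by (simp flip: times_clifford.abs_eq)
  qed
  then show ?thesis by (metis Quotient_abs_rep[OF Quotient_clifford])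
qed

section \<open>The automorphism and the star operation on generators and products\<close>

lemma cliff_eps_cvec [simp]: "cliff_eps (cvec v) = - cvec v"
  unfolding cvec_minus[symmetric] by transfer (simp add: ce_refl)

lemma cliff_eps_add: "cliff_eps (x + y) = cliff_eps x + cliff_eps y"
  by transfer (simp add: ce_refl)

lemma cliff_eps_mult: "cliff_eps (x * y) = cliff_eps x * cliff_eps y"
  by transfer (simp add: ce_refl)

lemma cliff_eps_one [simp]: "cliff_eps 1 = 1"
  by transfer (simp add: ce_refl)

lemma cliff_eps_scaleR: "cliff_eps (r *\<^sub>R x) = r *\<^sub>R cliff_eps x"
  by transfer (simp add: ce_refl)

lemma cliff_star_cvec [simp]: "cliff_star (cvec v) = - cvec v"
proof -
  have "cliff_transp (cvec v) = cvec v" by transfer (simp add: ce_refl)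
  then show ?thesis by (simp add: cliff_star_def)
qed

lemma cliff_star_mult: "cliff_star (x * y) = cliff_star y * cliff_star x"
proof -
  have "cliff_transp (x * y) = cliff_transp y * cliff_transp x" by transfer (simp add: ce_refl)
  then show ?thesis by (simp add: cliff_star_def cliff_eps_mult)
qed

lemma cliff_star_one [simp]: "cliff_star 1 = 1"
proof -
  have "cliff_transp 1 = (1 :: 'a clifford)" by transfer (simp add: ce_refl)
  then show ?thesis by (simp add: cliff_star_def)
qed

lemma cliff_star_scaleR: "cliff_star (r *\<^sub>R x) = r *\<^sub>R cliff_star x"
proof -
  have "cliff_transp (r *\<^sub>R x) = r *\<^sub>R cliff_transp x"
    by transfer (simp add: ce_sym[OF Scal_central])
  then show ?thesis by (simp add: cliff_star_def cliff_eps_scaleR)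
qed

section \<open>Spanning monomials and the twisted centralizer of the vectors\<close>

text \<open>These are the linear combinations of products of sublists, with letters in list order.
  The recursion isolates the leading letter.\<close>

fun monomial_span :: "'v::euclidean_space list \<Rightarrow> 'v clifford set" where
  "monomial_span [] = range of_real"
| "monomial_span (e # es) = {a + cvec e * b | a b. a \<in> monomial_span es \<and> b \<in> monomial_span es}"

lemma monomial_span_ConsI:
  "a \<in> monomial_span es \<Longrightarrow> b \<in> monomial_span es \<Longrightarrow> a + cvec e * b \<in> monomial_span (e # es)"
  by auto

lemma monomial_span_add: "x \<in> monomial_span es \<Longrightarrow> y \<in> monomial_span es \<Longrightarrow> x + y \<in> monomial_span es"
proof (induction es arbitrary: x y)
  case Nil
  then show ?case by (auto simp flip: of_real_add)
next
  case (Cons e es)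
  from Cons.prems obtain a b a' b' where "x = a + cvec e * b" "y = a' + cvec e * b'"
    and mem: "a \<in> monomial_span es" "b \<in> monomial_span es" "a' \<in> monomial_span es" "b' \<in> monomial_span es"
    by auto
  then have "x + y = (a + a') + cvec e * (b + b')" by (simp add: algebra_simps)
  with mem show ?case by (auto intro: Cons.IH)
qed

lemma monomial_span_scaleR: "x \<in> monomial_span es \<Longrightarrow> r *\<^sub>R x \<in> monomial_span es"
proof (induction es arbitrary: x)
  case Nil
  then show ?case by (auto simp: scaleR_conv_of_real simp flip: of_real_mult)
next
  case (Cons e es)
  then obtain a b where "x = a + cvec e * b" and mem: "a \<in> monomial_span es" "b \<in> monomial_span es"
    by auto
  then have "r *\<^sub>R x = r *\<^sub>R a + cvec e * (r *\<^sub>R b)" by (simp add: algebra_simps)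
  moreover have "r *\<^sub>R a + cvec e * (r *\<^sub>R b) \<in> monomial_span (e # es)"
    by (intro monomial_span_ConsI Cons.IH mem)
  ultimately show ?case by metis
qed

lemma monomial_span_one: "1 \<in> monomial_span es"
proof (induction es)
  case Nil
  show ?case using of_real_1 by (metis monomial_span.simps(1) rangeI)
next
  case (Cons e es)
  have "0 *\<^sub>R 1 \<in> monomial_span es" by (rule monomial_span_scaleR[OF Cons])
  from monomial_span_ConsI[OF Cons this] show ?case by simp
qed

lemma cvec_Basis_anticommute:
  assumes "e \<in> Basis" "f \<in> Basis" "e \<noteq> f"
  shows "cvec e * cvec f = - (cvec f * cvec e)"
  using cvec_clifford[of e f] assms by (simp add: inner_Basis eq_neg_iff_add_eq_0)

text \<open>If \<open>f\<close> is the leading letter it squares to 1 and exchanges the roles of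
  \<open>a\<close> and \<open>b\<close>. Otherwise it passes \<open>e\<close> with a change of sign
  and acts on the shorter list.\<close>

lemma monomial_span_cvec:
  assumes "set es \<subseteq> Basis" "f \<in> set es" "x \<in> monomial_span es"
  shows "cvec f * x \<in> monomial_span es"
  using assms
proof (induction es arbitrary: x)
  case (Cons e es)
  from Cons.prems(3) obtain a b where x: "x = a + cvec e * b"
    and mem: "a \<in> monomial_span es" "b \<in> monomial_span es"
    by auto
  show ?case
  proof (cases "f = e")
    case True
    have "cvec e * (cvec e * b) = b"
      using Cons.prems(1) by (simp flip: mult.assoc add: cvec_square)
    then have "cvec f * x = b + cvec e * a" by (simp add: x True distrib_left add.commute)
    with mem show ?thesis by auto
  next
    case False
    have "cvec f * (cvec e * b) = cvec e * ((- 1) *\<^sub>R (cvec f * b))"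
      using cvec_Basis_anticommute[of f e] Cons.prems False by (auto simp flip: mult.assoc)
    then have "cvec f * x = cvec f * a + cvec e * ((- 1) *\<^sub>R (cvec f * b))"
      by (simp add: x distrib_left)
    moreover have "cvec f * a \<in> monomial_span es" "cvec f * b \<in> monomial_span es"
      using Cons.IH Cons.prems False mem by auto
    then have "cvec f * a + cvec e * ((- 1) *\<^sub>R (cvec f * b)) \<in> monomial_span (e # es)"
      by (intro monomial_span_ConsI monomial_span_scaleR)
    ultimately show ?thesis by metis
  qed
qed simp

lemma monomial_span_Basis:
  assumes "set es = Basis"
  shows "(x :: 'v::euclidean_space clifford) \<in> monomial_span es"
proof -
  \<comment> \<open>Stability of the span under left multiplication by \<open>x\<close> is inherited
    by products of such \<open>x\<close>, which mere membership of \<open>x\<close> would not be.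
    Applying it to 1 gives the claim.\<close>
  have "\<forall>y \<in> monomial_span es. x * y \<in> monomial_span es"
  proof (induction x rule: clifford_induct)
    case (vec v)
    show ?case
    proof
      fix y assume y: "y \<in> monomial_span es"
      have sum: "(\<Sum>b\<in>B. (v \<bullet> b) *\<^sub>R (cvec b * y)) \<in> monomial_span es" if "B \<subseteq> Basis" for B
        using finite_subset[OF that finite_Basis] that
      proof induction
        case empty
        show ?case using monomial_span_scaleR[OF monomial_span_one, of 0] by simp
      next
        case (insert b B)
        then show ?case
          using assms y by (simp add: monomial_span_add monomial_span_scaleR monomial_span_cvec)
      qed
      have "cvec v * y = cvec (\<Sum>b\<in>Basis. (v \<bullet> b) *\<^sub>R b) * y"
        by (simp only: euclidean_representation)
      also have "\<dots> = (\<Sum>b\<in>Basis. (v \<bullet> b) *\<^sub>R (cvec b * y))"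
        by (simp only: cvec_sum cvec_scaleR sum_distrib_right scaleR_scaleR mult_scaleR_left)
      finally show "cvec v * y \<in> monomial_span es" using sum by simp
    qed
  next
    case (scal r)
    then show ?case by (simp add: monomial_span_scaleR flip: scaleR_conv_of_real)
  qed (auto simp: distrib_right mult.assoc monomial_span_add)
  then show ?thesis using monomial_span_one by fastforce
qed

text \<open>Each letter anticommutes with \<open>e\<close>, and \<open>cliff_eps\<close> contributes
  one sign per letter, so the signs cancel.\<close>

lemma monomial_span_twisted_commute:
  assumes "x \<in> monomial_span es" "set es \<subseteq> Basis" "e \<in> Basis" "e \<notin> set es"
  shows "cliff_eps x * cvec e = cvec e * x"
  using assms
proof (induction es arbitrary: x)
  case Nil
  then show ?case by (auto simp: of_real_def cliff_eps_scaleR)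
next
  case (Cons f es)
  from Cons.prems(1) obtain a b where x: "x = a + cvec f * b"
    and mem: "a \<in> monomial_span es" "b \<in> monomial_span es"
    by auto
  then have IH: "cliff_eps a * cvec e = cvec e * a" "cliff_eps b * cvec e = cvec e * b"
    using Cons by auto
  have "cvec f * cvec e = - (cvec e * cvec f)"
    using Cons.prems by (intro cvec_Basis_anticommute) auto
  then have "- (cvec f * (cvec e * b)) = cvec e * (cvec f * b)"
    by (simp flip: mult.assoc)
  then show ?case
    by (simp add: x cliff_eps_add cliff_eps_mult distrib_left distrib_right left_diff_distrib IH mult.assoc)
qed

text \<open>
  Members of the span for \<open>e # es\<close> are \<open>a + e b\<close> with \<open>a, b\<close> not involving \<open>e\<close>. Conjugation by \<open>e\<close>, twisted
  by \<open>cliff_eps\<close>, maps this to \<open>a - e b\<close>, so fixed elements lose the letter \<open>e\<close>; no linear independence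
  of the monomials is needed.
\<close>

lemma twisted_centralizer_monomial_span:
  assumes "x \<in> monomial_span es" "set es \<subseteq> Basis" "distinct es"
    and "\<And>e. e \<in> set es \<Longrightarrow> cliff_eps x * cvec e = cvec e * x"
  shows "x \<in> range of_real"
  using assms
proof (induction es arbitrary: x)
  case (Cons e es)
  from Cons.prems(1) obtain a b where x: "x = a + cvec e * b"
    and mem: "a \<in> monomial_span es" "b \<in> monomial_span es"
    by auto
  have e: "cliff_eps a * cvec e = cvec e * a" "cliff_eps b * cvec e = cvec e * b"
    using monomial_span_twisted_commute mem Cons.prems by auto
  have sq: "cvec e * (cvec e * b) = b"
    using Cons.prems(2) by (simp flip: mult.assoc add: cvec_square)
  have "cliff_eps x * cvec e = cvec e * x" using Cons.prems by simp
  \<comment> \<open>With \<open>e\<close> read as its Clifford element, the left side of the fixed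
    point equation is \<open>e a - b\<close> and the right side is \<open>e a + b\<close>.\<close>
  then have "b = - b"
    by (simp add: x cliff_eps_add cliff_eps_mult distrib_left distrib_right left_diff_distrib e mult.assoc sq)
  then have "2 *\<^sub>R b = 0" by (metis add.right_inverse scaleR_2)
  then have "x = a" by (simp add: x)
  then show ?case using Cons mem by auto
qed simp

text \<open>Applied below to the quotient of two lifts of one isometry, this makes the kernel of the
  projection consist of scalars.\<close>

lemma twisted_centralizer:
  assumes "\<And>y. cliff_eps x * cvec y = cvec y * x"
  shows "\<exists>r. x = of_real r"
proof -
  obtain es :: "'a list" where "set es = Basis" "distinct es"
    using finite_distinct_list[OF finite_Basis] by blast
  then have "x \<in> range of_real"
    using assms by (intro twisted_centralizer_monomial_span[of x es] monomial_span_Basis) auto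
  then show ?thesis by auto
qed

section \<open>Elements of the Pin group\<close>

lemma cliff_inv_eq:
  assumes "\<eta> * \<zeta> = 1" "\<zeta> * \<eta> = 1"
  shows "cliff_inv \<eta> = \<zeta>"
  unfolding cliff_inv_def
proof (rule the_equality)
  fix \<xi> assume "\<eta> * \<xi> = 1 \<and> \<xi> * \<eta> = 1"
  then have "\<zeta> * (\<eta> * \<xi>) = \<zeta>" by simp
  then show "\<xi> = \<zeta>" by (simp flip: mult.assoc add: assms)
qed (simp add: assms)

text \<open>Both description operators, for the inverse and for the preimage under
  \<open>cvec\<close>, are resolved here. What remains is an equation without inverses.\<close>

lemma Pin_intertwines:
  assumes "\<eta> \<in> Pin"
  shows "cliff_eps \<eta> * cvec y = cvec (pin_proj \<eta> y) * \<eta>"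
proof -
  obtain \<zeta> where \<zeta>: "\<eta> * \<zeta> = 1" "\<zeta> * \<eta> = 1"
    using assms by (auto simp: Pin_def cliff_invertible_def)
  obtain x where x: "cliff_eps \<eta> * cvec y * \<zeta> = cvec x"
    using assms cliff_inv_eq[OF \<zeta>] by (auto simp: Pin_def)
  then have "pin_proj \<eta> y = x"
    by (simp add: pin_proj_def cliff_inv_eq[OF \<zeta>])
  then show ?thesis
    by (simp flip: x add: mult.assoc \<zeta>)
qed

section \<open>Lifts of isometries\<close>

text \<open>A certificate that \<eta> lies in \<open>Pin\<close> above \<open>w\<close>, in a form
  that passes to products. The sign \<open>r\<close> is the norm of \<eta>; having it on both sides
  makes \<open>r *\<^sub>R cliff_star \<eta>\<close> a two-sided inverse.\<close>

definition pin_lift :: "'v::euclidean_space clifford \<Rightarrow> ('v \<Rightarrow> 'v) \<Rightarrow> bool" where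
  "pin_lift \<eta> w \<longleftrightarrow> (\<forall>y. cliff_eps \<eta> * cvec y = cvec (w y) * \<eta>)
     \<and> (\<exists>r. r * r = 1 \<and> cliff_star \<eta> * \<eta> = r *\<^sub>R 1 \<and> \<eta> * cliff_star \<eta> = r *\<^sub>R 1)"

lemma pin_liftI:
  assumes "\<And>y. cliff_eps \<eta> * cvec y = cvec (w y) * \<eta>"
    and "r * r = 1" "cliff_star \<eta> * \<eta> = r *\<^sub>R 1" "\<eta> * cliff_star \<eta> = r *\<^sub>R 1"
  shows "pin_lift \<eta> w"
  unfolding pin_lift_def by (intro conjI allI exI[of _ r] assms)

lemma pin_liftE:
  assumes "pin_lift \<eta> w"
  obtains r where "r * r = 1" "cliff_star \<eta> * \<eta> = r *\<^sub>R 1" "\<eta> * cliff_star \<eta> = r *\<^sub>R 1"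
proof -
  have "\<exists>r. r * r = 1 \<and> cliff_star \<eta> * \<eta> = r *\<^sub>R 1 \<and> \<eta> * cliff_star \<eta> = r *\<^sub>R 1"
    using assms by (simp only: pin_lift_def)
  with that show thesis by (elim exE conjE)
qed

lemma pin_lift_intertwines: "pin_lift \<eta> w \<Longrightarrow> cliff_eps \<eta> * cvec y = cvec (w y) * \<eta>"
  by (simp only: pin_lift_def)

lemma pin_lift_one: "pin_lift 1 id"
  by (rule pin_liftI[where r = 1]) simp_all

lemma pin_lift_mult:
  assumes \<eta>: "pin_lift \<eta> w" and \<zeta>: "pin_lift \<zeta> v"
  shows "pin_lift (\<eta> * \<zeta>) (w \<circ> v)"
proof -
  obtain r where r: "r * r = 1" "cliff_star \<eta> * \<eta> = r *\<^sub>R 1" "\<eta> * cliff_star \<eta> = r *\<^sub>R 1"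
    using \<eta> by (rule pin_liftE)
  obtain s where s: "s * s = 1" "cliff_star \<zeta> * \<zeta> = s *\<^sub>R 1" "\<zeta> * cliff_star \<zeta> = s *\<^sub>R 1"
    using \<zeta> by (rule pin_liftE)
  show ?thesis
  proof (rule pin_liftI)
    show "(r * s) * (r * s) = 1"
      using r(1) s(1) by (metis mult.assoc mult.commute mult_1_left)
    have "cliff_star (\<eta> * \<zeta>) * (\<eta> * \<zeta>) = cliff_star \<zeta> * (cliff_star \<eta> * \<eta>) * \<zeta>"
      by (simp only: cliff_star_mult mult.assoc)
    then show "cliff_star (\<eta> * \<zeta>) * (\<eta> * \<zeta>) = (r * s) *\<^sub>R 1"
      by (simp add: r s)
    have "\<eta> * \<zeta> * cliff_star (\<eta> * \<zeta>) = \<eta> * (\<zeta> * cliff_star \<zeta>) * cliff_star \<eta>"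
      by (simp only: cliff_star_mult mult.assoc)
    then show "\<eta> * \<zeta> * cliff_star (\<eta> * \<zeta>) = (r * s) *\<^sub>R 1"
      by (simp add: r s mult.commute)
    fix y
    have "cliff_eps (\<eta> * \<zeta>) * cvec y = cliff_eps \<eta> * cvec (v y) * \<zeta>"
      by (simp only: cliff_eps_mult mult.assoc pin_lift_intertwines[OF \<zeta>])
    then show "cliff_eps (\<eta> * \<zeta>) * cvec y = cvec ((w \<circ> v) y) * (\<eta> * \<zeta>)"
      by (simp add: pin_lift_intertwines[OF \<eta>] mult.assoc)
  qed
qed

lemma pin_lift_invertible:
  assumes "pin_lift \<eta> w"
  obtains \<zeta> where "\<eta> * \<zeta> = 1" "\<zeta> * \<eta> = 1"
proof -
  obtain r where "r * r = 1" "cliff_star \<eta> * \<eta> = r *\<^sub>R 1" "\<eta> * cliff_star \<eta> = r *\<^sub>R 1"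
    using assms by (rule pin_liftE)
  then have "\<eta> * (r *\<^sub>R cliff_star \<eta>) = 1" "r *\<^sub>R cliff_star \<eta> * \<eta> = 1" by simp_all
  then show ?thesis by (rule that)
qed

lemma pin_lift_star_square:
  assumes "pin_lift \<eta> w"
  shows "(cliff_star \<eta> * \<eta>)\<^sup>2 = 1"
  using assms by (rule pin_liftE) (simp add: power2_eq_square)

lemma pin_lift_Pin:
  assumes "pin_lift \<eta> w"
  shows "\<eta> \<in> Pin" "pin_proj \<eta> = w"
proof -
  obtain \<zeta> where \<zeta>: "\<eta> * \<zeta> = 1" "\<zeta> * \<eta> = 1"
    using pin_lift_invertible[OF assms] .
  have conj: "cliff_eps \<eta> * cvec y * cliff_inv \<eta> = cvec (w y)" for y
    by (simp add: cliff_inv_eq[OF \<zeta>] pin_lift_intertwines[OF assms] mult.assoc \<zeta>)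
  then show "pin_proj \<eta> = w" by (auto simp: pin_proj_def)
  show "\<eta> \<in> Pin"
    using \<zeta> conj pin_lift_star_square[OF assms] unfolding Pin_def cliff_invertible_def by blast
qed

text \<open>The inverse of \<zeta> times \<eta> lies above the identity, hence is a real scalar
  \<open>r\<close>. Comparing norms gives r^4 = 1, so \<open>r\<close> is 1 or -1.\<close>

lemma pin_lift_unique:
  assumes \<eta>: "\<eta> \<in> Pin" and \<zeta>: "pin_lift \<zeta> (pin_proj \<eta>)"
  shows "\<eta> = \<zeta> \<or> \<eta> = - \<zeta>"
proof -
  obtain \<xi> where \<xi>: "\<zeta> * \<xi> = 1" "\<xi> * \<zeta> = 1"
    using pin_lift_invertible[OF \<zeta>] .
  have eps: "cliff_eps \<xi> * cliff_eps \<zeta> = 1"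
    by (simp flip: cliff_eps_mult add: \<xi>)
  have "cliff_eps (\<xi> * \<eta>) * cvec y = cvec y * (\<xi> * \<eta>)" for y
  proof -
    have "cliff_eps (\<xi> * \<eta>) * cvec y = cliff_eps \<xi> * (cvec (pin_proj \<eta> y) * (\<zeta> * \<xi>)) * \<eta>"
      by (simp add: cliff_eps_mult Pin_intertwines[OF \<eta>] mult.assoc \<xi>)
    also have "\<dots> = cliff_eps \<xi> * (cliff_eps \<zeta> * cvec y) * (\<xi> * \<eta>)"
      by (simp only: pin_lift_intertwines[OF \<zeta>] mult.assoc)
    also have "\<dots> = (cliff_eps \<xi> * cliff_eps \<zeta>) * (cvec y * (\<xi> * \<eta>))"
      by (simp only: mult.assoc)
    finally show ?thesis by (simp add: eps)
  qed
  then obtain r where "\<xi> * \<eta> = of_real r" using twisted_centralizer by blast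
  then have "\<zeta> * (\<xi> * \<eta>) = \<zeta> * of_real r" by simp
  then have r: "\<eta> = r *\<^sub>R \<zeta>" by (simp flip: mult.assoc add: \<xi> of_real_def)
  note pin_lift_star_square[OF \<zeta>]
  moreover have "(cliff_star \<eta> * \<eta>)\<^sup>2 = (r ^ 4) *\<^sub>R (cliff_star \<zeta> * \<zeta>)\<^sup>2"
    by (simp add: r cliff_star_scaleR power2_eq_square mult.assoc power4_eq_xxxx)
  ultimately have "of_real (r ^ 4) = (1 :: 'a clifford)"
    using \<eta> by (simp add: Pin_def of_real_def)
  then have "(r\<^sup>2)\<^sup>2 = 1" by (simp flip: power_mult del: of_real_power)
  then have "r\<^sup>2 = 1 \<or> r\<^sup>2 = - 1" by (rule power2_eq_1_iff[THEN iffD1])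
  then have "r\<^sup>2 = 1" using zero_le_power2[of r] by linarith
  then have "r = 1 \<or> r = - 1" by (rule power2_eq_1_iff[THEN iffD1])
  then show ?thesis using r by auto
qed

section \<open>Roots and their Clifford elements\<close>

text \<open>This is precomposition with the reflection in \<gamma>. For a root \<gamma> that
  reflection is an involution, so this is its action on the dual space.\<close>

abbreviation root_refl :: "('v::euclidean_space dual \<Rightarrow> 'v) \<Rightarrow> 'v dual \<Rightarrow> 'v dual \<Rightarrow> 'v dual" where
  "root_refl cor \<gamma> \<alpha> \<equiv> \<alpha> - blinfun_apply \<alpha> (cor \<gamma>) *\<^sub>R \<gamma>"

lemma root_refl_apply: "blinfun_apply (root_refl cor \<gamma> \<alpha>) y = blinfun_apply \<alpha> (reflection cor \<gamma> y)"
  by (simp add: reflection_def blinfun.diff_left blinfun.diff_right blinfun.scaleR_left blinfun.scaleR_right)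

lemma s_tilde_eq_cvec: "s_tilde cor \<alpha> = cvec (sgn (cor \<alpha>))"
  by (simp add: s_tilde_def sgn_div_norm cvec_scaleR)

locale roots =
  fixes R :: "'v::euclidean_space dual set" and cor :: "'v dual \<Rightarrow> 'v"
  assumes root_system: "root_system R cor"
begin

lemma root_cor [simp]: "\<alpha> \<in> R \<Longrightarrow> blinfun_apply \<alpha> (cor \<alpha>) = 2"
  using root_system by (simp add: root_system_def)

lemma cor_nonzero: "\<alpha> \<in> R \<Longrightarrow> cor \<alpha> \<noteq> 0"
  using root_cor[of \<alpha>] by (metis blinfun.zero_right zero_neq_numeral)

lemma orthogonal_reflection: "\<alpha> \<in> R \<Longrightarrow> orthogonal_transformation (reflection cor \<alpha>)"
  using root_system by (simp add: root_system_def)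

lemma root_refl_in: "\<gamma> \<in> R \<Longrightarrow> \<alpha> \<in> R \<Longrightarrow> root_refl cor \<gamma> \<alpha> \<in> R"
  using root_system by (simp add: root_system_def)

lemma root_scale: "\<alpha> \<in> R \<Longrightarrow> t *\<^sub>R \<alpha> \<in> R \<Longrightarrow> t = 1 \<or> t = -1"
  using root_system by (simp add: root_system_def)

lemma root_refl_self: "\<gamma> \<in> R \<Longrightarrow> root_refl cor \<gamma> \<gamma> = - \<gamma>"
  by (simp add: scaleR_2)

lemma uminus_root: "\<alpha> \<in> R \<Longrightarrow> - \<alpha> \<in> R"
  using root_refl_in[of \<alpha> \<alpha>] by (simp only: root_refl_self)

lemma root_refl_root_refl:
  "\<gamma> \<in> R \<Longrightarrow> root_refl cor \<gamma> (root_refl cor \<gamma> \<alpha>) = \<alpha>"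
  by (simp add: blinfun.diff_left blinfun.scaleR_left algebra_simps)

lemma reflection_reflection: "\<alpha> \<in> R \<Longrightarrow> reflection cor \<alpha> \<circ> reflection cor \<alpha> = id"
  by (auto simp: reflection_def blinfun.diff_right blinfun.scaleR_right algebra_simps)

section \<open>Coroots and their equivariance\<close>

text \<open>The reflection preserves inner products and negates the coroot. Comparing the product of
  \<open>y\<close> and the coroot before and after expresses the functional \<alpha> through its
  coroot.\<close>

lemma root_apply:
  assumes "\<alpha> \<in> R"
  shows "blinfun_apply \<alpha> y * (cor \<alpha> \<bullet> cor \<alpha>) = 2 * (y \<bullet> cor \<alpha>)"
proof -
  have "reflection cor \<alpha> (cor \<alpha>) = - cor \<alpha>"
    using assms by (simp add: reflection_def scaleR_2)
  moreover have "reflection cor \<alpha> y \<bullet> reflection cor \<alpha> (cor \<alpha>) = y \<bullet> cor \<alpha>"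
    using orthogonal_reflection[OF assms] by (simp add: orthogonal_transformation_def)
  ultimately show ?thesis by (simp add: reflection_def inner_diff_left)
qed

text \<open>Evaluating the formulas for the coroot \<open>u\<close> and for \<open>v\<close> at each
  other gives u.u = u.v = v.v, so \<open>u - v\<close> has length zero.\<close>

lemma cor_unique:
  assumes "\<alpha> \<in> R" "v \<noteq> 0" "\<And>y. blinfun_apply \<alpha> y * (v \<bullet> v) = 2 * (y \<bullet> v)"
  shows "cor \<alpha> = v"
proof -
  let ?u = "cor \<alpha>"
  have u: "?u \<bullet> ?u \<noteq> 0" and v: "v \<bullet> v \<noteq> 0" using cor_nonzero assms by simp_all
  have "2 * (v \<bullet> v) = 2 * (?u \<bullet> v)" using assms(3)[of ?u] assms(1) by simp
  then have vv: "v \<bullet> v = ?u \<bullet> v" by simp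
  have "blinfun_apply \<alpha> v * (v \<bullet> v) = 2 * (v \<bullet> v)" using assms(3)[of v] by simp
  then have "blinfun_apply \<alpha> v = 2" using v by simp
  then have "?u \<bullet> ?u = v \<bullet> ?u" using root_apply[OF assms(1), of v] by simp
  with vv have "(?u - v) \<bullet> (?u - v) = 0" by (simp add: inner_diff_left inner_diff_right inner_commute)
  then show ?thesis by simp
qed

text \<open>Equivariance of \<open>cor\<close> is not postulated in \<open>root_system\<close>. It
  follows from uniqueness, because the reflected coroot satisfies the formula of
  \<open>root_apply\<close> for the reflected root.\<close>

lemma cor_root_refl:
  assumes "\<gamma> \<in> R" "\<alpha> \<in> R"
  shows "cor (root_refl cor \<gamma> \<alpha>) = reflection cor \<gamma> (cor \<alpha>)"
proof (rule cor_unique)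
  let ?s = "reflection cor \<gamma>"
  have inner: "?s x \<bullet> ?s y = x \<bullet> y" for x y
    using orthogonal_reflection[OF assms(1)] by (simp add: orthogonal_transformation_def)
  have invol: "?s (?s y) = y" for y
    using reflection_reflection[OF assms(1)] by (metis comp_apply id_apply)
  show "root_refl cor \<gamma> \<alpha> \<in> R" using assms by (rule root_refl_in)
  have "?s (cor \<alpha>) \<bullet> ?s (cor \<alpha>) \<noteq> 0" using cor_nonzero[OF assms(2)] by (simp add: inner)
  then show "?s (cor \<alpha>) \<noteq> 0" by auto
  fix y
  have "?s y \<bullet> cor \<alpha> = y \<bullet> ?s (cor \<alpha>)" using inner[of "?s y" "cor \<alpha>"] by (simp add: invol)
  then show "blinfun_apply (root_refl cor \<gamma> \<alpha>) y * (?s (cor \<alpha>) \<bullet> ?s (cor \<alpha>)) = 2 * (y \<bullet> ?s (cor \<alpha>))"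
    by (simp only: root_refl_apply inner root_apply[OF assms(2)])
qed

lemma sgn_cor_inner [simp]: "\<alpha> \<in> R \<Longrightarrow> sgn (cor \<alpha>) \<bullet> sgn (cor \<alpha>) = 1"
  using cor_nonzero[of \<alpha>] norm_sgn[of "cor \<alpha>"] by (simp add: dot_square_norm)

lemma reflection_sgn:
  assumes "\<alpha> \<in> R"
  shows "reflection cor \<alpha> y = y - (2 * (y \<bullet> sgn (cor \<alpha>))) *\<^sub>R sgn (cor \<alpha>)"
proof -
  have "cor \<alpha> \<bullet> cor \<alpha> \<noteq> 0" using cor_nonzero[OF assms] by simp
  then have "blinfun_apply \<alpha> y = 2 * (y \<bullet> cor \<alpha>) / (norm (cor \<alpha>) * norm (cor \<alpha>))"
    using root_apply[OF assms, of y]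
    by (simp add: field_simps flip: power2_eq_square power2_norm_eq_inner)
  then show ?thesis by (simp add: reflection_def sgn_div_norm field_simps)
qed

lemma sgn_cor_root_refl:
  assumes "\<gamma> \<in> R" "\<alpha> \<in> R"
  shows "sgn (cor (root_refl cor \<gamma> \<alpha>)) = reflection cor \<gamma> (sgn (cor \<alpha>))"
  using orthogonal_reflection[OF assms(1)]
  by (simp add: cor_root_refl[OF assms] sgn_div_norm orthogonal_transformation_norm
      linear_scale orthogonal_transformation_linear)

section \<open>Relations between the lifted reflections\<close>

lemma s_tilde_square: "\<alpha> \<in> R \<Longrightarrow> s_tilde cor \<alpha> * s_tilde cor \<alpha> = 1"
  by (simp add: s_tilde_eq_cvec cvec_square)

lemma s_tilde_conj:
  assumes "\<gamma> \<in> R" "\<alpha> \<in> R"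
  shows "s_tilde cor \<gamma> * s_tilde cor \<alpha> * s_tilde cor \<gamma> = - s_tilde cor (root_refl cor \<gamma> \<alpha>)"
  using assms by (simp only: s_tilde_eq_cvec sgn_cor_root_refl cvec_reflection sgn_cor_inner reflection_sgn)

lemma s_tilde_commute:
  assumes "\<gamma> \<in> R" "\<alpha> \<in> R"
  shows "s_tilde cor \<gamma> * s_tilde cor \<alpha> = - (s_tilde cor (root_refl cor \<gamma> \<alpha>) * s_tilde cor \<gamma>)"
proof -
  have "s_tilde cor \<gamma> * s_tilde cor \<alpha> = s_tilde cor \<gamma> * s_tilde cor \<alpha> * s_tilde cor \<gamma> * s_tilde cor \<gamma>"
    by (simp only: mult.assoc s_tilde_square[OF assms(1)] mult_1_right)
  then show ?thesis by (simp only: s_tilde_conj[OF assms] mult_minus_left)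
qed

lemma s_tilde_uminus: "\<alpha> \<in> R \<Longrightarrow> s_tilde cor (- \<alpha>) = - s_tilde cor \<alpha>"
  using s_tilde_conj[of \<alpha> \<alpha>] by (simp only: root_refl_self s_tilde_square mult_1_left minus_minus)

text \<open>The sign from \<open>cliff_eps\<close> cancels the one in
  \<open>cvec_reflection\<close>. The norm is -1 because the star negates a vector and the unit
  coroot squares to 1.\<close>

lemma pin_lift_s_tilde:
  assumes "\<alpha> \<in> R"
  shows "pin_lift (s_tilde cor \<alpha>) (reflection cor \<alpha>)"
proof (rule pin_liftI[where r = "-1"])
  let ?n = "cvec (sgn (cor \<alpha>))"
  have n: "?n * ?n = 1" using assms by (simp add: cvec_square)
  fix y
  have "?n * cvec y = ?n * cvec y * ?n * ?n" by (simp only: mult.assoc n mult_1_right)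
  then show "cliff_eps (s_tilde cor \<alpha>) * cvec y = cvec (reflection cor \<alpha> y) * s_tilde cor \<alpha>"
    using assms by (simp add: s_tilde_eq_cvec reflection_sgn cvec_reflection)
qed (use assms in \<open>simp_all add: s_tilde_eq_cvec cvec_square\<close>)

lemma reflection_in_refl_group: "\<alpha> \<in> R \<Longrightarrow> reflection cor \<alpha> \<in> refl_group R cor"
  by (simp add: refl_group_def generate.incl)

lemma s_tilde_mult_in_W_tilde:
  assumes "\<alpha> \<in> R" "\<beta> \<in> R"
  shows "s_tilde cor \<alpha> * s_tilde cor \<beta> \<in> carrier (W_tilde R cor)"
proof -
  have "pin_lift (s_tilde cor \<alpha> * s_tilde cor \<beta>) (reflection cor \<alpha> \<circ> reflection cor \<beta>)"
    using assms by (intro pin_lift_mult pin_lift_s_tilde)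
  moreover have "reflection cor \<alpha> \<circ> reflection cor \<beta> \<in> refl_group R cor"
    using generate.eng[of "reflection cor \<alpha>" orthogonal_group "reflection cor ` R" "reflection cor \<beta>"]
      reflection_in_refl_group assms
    by (simp add: refl_group_def orthogonal_group_def)
  ultimately show ?thesis using pin_lift_Pin by (force simp: W_tilde_def)
qed

text \<open>Each \<open>w\<close> in the reflection group has some lift that is a product of lifted
  reflections and so satisfies \<open>P\<close>. An arbitrary element above \<open>w\<close> differs
  from it by a sign at most, which the case \<open>- 1\<close> absorbs.\<close>

lemma W_tilde_induct [consumes 1, case_names one minus_one root mult]:
  assumes "\<eta> \<in> carrier (W_tilde R cor)"
    and one: "P 1" and minus_one: "P (- 1)" and root: "\<And>\<alpha>. \<alpha> \<in> R \<Longrightarrow> P (s_tilde cor \<alpha>)"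
    and mult: "\<And>\<eta> \<zeta>. P \<eta> \<Longrightarrow> P \<zeta> \<Longrightarrow> P (\<eta> * \<zeta>)"
  shows "P \<eta>"
proof -
  have "\<exists>\<zeta>. pin_lift \<zeta> w \<and> P \<zeta>" if "w \<in> generate orthogonal_group (reflection cor ` R)" for w
    using that
  proof induction
    case one
    show ?case using pin_lift_one assms(2) by (auto simp: orthogonal_group_def id_def)
  next
    case (incl h)
    then show ?case using pin_lift_s_tilde root by blast
  next
    case (inv h)
    then obtain \<alpha> where \<alpha>: "\<alpha> \<in> R" "h = reflection cor \<alpha>" by blast
    \<comment> \<open>\<open>generate\<close> also admits inverses of generators; reflections are
      involutions, so these are generators again.\<close>
    have "inv\<^bsub>orthogonal_group\<^esub> h = h"
      unfolding m_inv_def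
    proof (rule the_equality)
      fix y assume "y \<in> carrier orthogonal_group \<and>
        h \<otimes>\<^bsub>orthogonal_group\<^esub> y = \<one>\<^bsub>orthogonal_group\<^esub> \<and> y \<otimes>\<^bsub>orthogonal_group\<^esub> h = \<one>\<^bsub>orthogonal_group\<^esub>"
      then have "y \<circ> h = id" by (simp add: orthogonal_group_def)
      then have "y \<circ> (h \<circ> h) = h" by (simp flip: comp_assoc)
      then show "y = h" by (simp add: \<alpha> reflection_reflection)
    qed (use \<alpha> in \<open>simp add: orthogonal_group_def reflection_reflection orthogonal_reflection\<close>)
    then show ?case using \<alpha> pin_lift_s_tilde root by metis
  next
    case (eng h1 h2)
    then obtain \<zeta>1 \<zeta>2 where "pin_lift \<zeta>1 h1" "P \<zeta>1" "pin_lift \<zeta>2 h2" "P \<zeta>2" by blast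
    then have "pin_lift (\<zeta>1 * \<zeta>2) (h1 \<circ> h2)" "P (\<zeta>1 * \<zeta>2)"
      by (simp_all add: pin_lift_mult mult)
    moreover have "h1 \<otimes>\<^bsub>orthogonal_group\<^esub> h2 = h1 \<circ> h2" by (simp add: orthogonal_group_def)
    ultimately show ?case by (intro exI[of _ "\<zeta>1 * \<zeta>2"]) (simp only:)
  qed
  then obtain \<zeta> where \<zeta>: "pin_lift \<zeta> (pin_proj \<eta>)" "P \<zeta>"
    using assms(1) by (auto simp: W_tilde_def refl_group_def)
  have "\<eta> = \<zeta> \<or> \<eta> = - 1 * \<zeta>"
    using pin_lift_unique[OF _ \<zeta>(1)] assms(1) by (simp add: W_tilde_def)
  then show ?thesis using \<zeta>(2) mult[OF minus_one \<zeta>(2)] by metis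
qed

end

section \<open>Positive and simple roots\<close>

locale simple_root_system = roots R cor
  for R :: "'v::euclidean_space dual set" and cor :: "'v dual \<Rightarrow> 'v" +
  fixes Rp \<Delta> :: "'v dual set"
  assumes positive: "positive_system R Rp" and simple: "simple_roots Rp \<Delta>"
begin

lemma Rp_subset: "Rp \<subseteq> R"
  using positive by (auto simp: positive_system_def)

lemma Delta_subset: "\<Delta> \<subseteq> Rp"
  using simple by (simp add: simple_roots_def)

lemma finite_Rp: "finite Rp"
  using Rp_subset root_system by (auto simp: root_system_def intro: finite_subset)

lemma finite_Delta: "finite \<Delta>"
  using Delta_subset finite_Rp by (rule finite_subset)

lemma positive_or_negative: "\<alpha> \<in> R \<Longrightarrow> \<alpha> \<in> Rp \<or> - \<alpha> \<in> Rp"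
  using positive uminus_root unfolding positive_system_def
  by (force simp: blinfun.minus_left)

lemma positive_combination:
  assumes "\<alpha> \<in> Rp"
  obtains a where "\<And>\<delta>. \<delta> \<in> \<Delta> \<Longrightarrow> a \<delta> \<ge> 0" "\<alpha> = (\<Sum>\<delta>\<in>\<Delta>. a \<delta> *\<^sub>R \<delta>)"
proof -
  have "\<exists>a. (\<forall>\<delta>\<in>\<Delta>. a \<delta> \<ge> 0) \<and> \<alpha> = (\<Sum>\<delta>\<in>\<Delta>. a \<delta> *\<^sub>R \<delta>)"
    using simple assms by (simp add: simple_roots_def)
  with that show thesis by blast
qed

text \<open>If the image were negative, \<alpha> and its negated image would be non-negative
  combinations of simple roots adding up to a multiple of \<delta>. Independence then makes \<alpha>
  itself a multiple of \<delta>. The image cannot be \<delta> either, since then \<alpha> would be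
  -\<delta>.\<close>

lemma root_refl_simple:
  assumes \<delta>: "\<delta> \<in> \<Delta>" and \<alpha>: "\<alpha> \<in> Rp" "\<alpha> \<noteq> \<delta>"
  shows "root_refl cor \<delta> \<alpha> \<in> Rp - {\<delta>}"
proof -
  have \<delta>R: "\<delta> \<in> R" and \<alpha>R: "\<alpha> \<in> R" using \<delta> \<alpha> Delta_subset Rp_subset by auto
  define \<beta> where "\<beta> = root_refl cor \<delta> \<alpha>"
  have \<beta>R: "\<beta> \<in> R" unfolding \<beta>_def using \<delta>R \<alpha>R by (rule root_refl_in)
  have "\<beta> \<in> Rp"
  proof (rule ccontr)
    assume "\<beta> \<notin> Rp"
    then have "- \<beta> \<in> Rp" using positive_or_negative[OF \<beta>R] by simp
    then obtain b where b: "\<And>\<epsilon>. \<epsilon> \<in> \<Delta> \<Longrightarrow> b \<epsilon> \<ge> 0" "- \<beta> = (\<Sum>\<epsilon>\<in>\<Delta>. b \<epsilon> *\<^sub>R \<epsilon>)"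
      using positive_combination by blast
    obtain a where a: "\<And>\<epsilon>. \<epsilon> \<in> \<Delta> \<Longrightarrow> a \<epsilon> \<ge> 0" "\<alpha> = (\<Sum>\<epsilon>\<in>\<Delta>. a \<epsilon> *\<^sub>R \<epsilon>)"
      using positive_combination \<alpha>(1) by blast
    define k where "k = blinfun_apply \<alpha> (cor \<delta>)"
    have single: "(\<Sum>\<epsilon>\<in>\<Delta>. (if \<epsilon> = \<delta> then t else 0) *\<^sub>R \<epsilon>) = t *\<^sub>R \<delta>" for t
      using \<delta> finite_Delta by (simp add: if_distrib[of "\<lambda>x. x *\<^sub>R _"] cong: if_cong)
    have "(\<Sum>\<epsilon>\<in>\<Delta>. (a \<epsilon> + b \<epsilon> - (if \<epsilon> = \<delta> then k else 0)) *\<^sub>R \<epsilon>) = \<alpha> + - \<beta> - k *\<^sub>R \<delta>"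
      by (simp only: scaleR_diff_left scaleR_add_left sum_subtractf sum.distrib single a(2)[symmetric] b(2)[symmetric])
    also have "\<dots> = 0" by (simp add: \<beta>_def k_def)
    finally have comb: "(\<Sum>\<epsilon>\<in>\<Delta>. (a \<epsilon> + b \<epsilon> - (if \<epsilon> = \<delta> then k else 0)) *\<^sub>R \<epsilon>) = 0" .
    have "independent \<Delta>" using simple by (simp add: simple_roots_def)
    then have "\<forall>\<epsilon>\<in>\<Delta>. a \<epsilon> + b \<epsilon> - (if \<epsilon> = \<delta> then k else 0) = 0"
      by (intro ballI) (rule independentD[OF _ finite_Delta order_refl comb])
    \<comment> \<open>Away from \<delta> two non-negative coefficients add up to zero, so both
      vanish.\<close>
    then have "a \<epsilon> = (if \<epsilon> = \<delta> then a \<delta> else 0)" if "\<epsilon> \<in> \<Delta>" for \<epsilon>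
      using a(1)[OF that] b(1)[OF that] that by (cases "\<epsilon> = \<delta>") (auto dest!: bspec[OF _ that])
    then have "(\<Sum>\<epsilon>\<in>\<Delta>. a \<epsilon> *\<^sub>R \<epsilon>) = (\<Sum>\<epsilon>\<in>\<Delta>. (if \<epsilon> = \<delta> then a \<delta> else 0) *\<^sub>R \<epsilon>)"
      by (intro sum.cong refl) metis
    then have \<alpha>\<delta>: "\<alpha> = a \<delta> *\<^sub>R \<delta>" using a(2) single by simp
    then have "a \<delta> = 1 \<or> a \<delta> = - 1" using root_scale[OF \<delta>R] \<alpha>R by metis
    then have "\<alpha> = \<delta>" using \<alpha>\<delta> a(1)[OF \<delta>] by auto
    with \<alpha>(2) show False ..
  qed
  moreover have "\<beta> \<noteq> \<delta>"
  proof
    assume "\<beta> = \<delta>"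
    then have "\<alpha> = - \<delta>"
      using root_refl_root_refl[OF \<delta>R, of \<alpha>] root_refl_self[OF \<delta>R] by (simp only: \<beta>_def)
    moreover have "\<delta> \<in> Rp" using \<delta> Delta_subset by auto
    ultimately show False
      using \<alpha>(1) positive by (auto simp: positive_system_def blinfun.minus_left)
  qed
  ultimately show ?thesis by (simp add: \<beta>_def)
qed

lemma bij_betw_root_refl_simple:
  assumes "\<delta> \<in> \<Delta>"
  shows "bij_betw (root_refl cor \<delta>) (Rp - {\<delta>}) (Rp - {\<delta>})"
proof (rule bij_betw_byWitness[where f' = "root_refl cor \<delta>"])
  have \<delta>R: "\<delta> \<in> R" using assms Delta_subset Rp_subset by auto
  show "\<forall>\<alpha>\<in>Rp - {\<delta>}. root_refl cor \<delta> (root_refl cor \<delta> \<alpha>) = \<alpha>"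
    by (simp only: root_refl_root_refl[OF \<delta>R] ball_triv simp_thms)
  then show "\<forall>\<alpha>\<in>Rp - {\<delta>}. root_refl cor \<delta> (root_refl cor \<delta> \<alpha>) = \<alpha>" .
  show "root_refl cor \<delta> ` (Rp - {\<delta>}) \<subseteq> Rp - {\<delta>}"
    by (rule image_subsetI, rule root_refl_simple[OF assms]) simp_all
  then show "root_refl cor \<delta> ` (Rp - {\<delta>}) \<subseteq> Rp - {\<delta>}" .
qed

text \<open>Expanding \<alpha> in simple roots and evaluating at its own coroot gives 2 > 0, so some
  simple root is positive on that coroot. By \<open>root_apply\<close> this sign is symmetric in the
  two roots.\<close>

lemma simple_root_acute:
  assumes "\<alpha> \<in> Rp"
  obtains \<delta> where "\<delta> \<in> \<Delta>" "blinfun_apply \<alpha> (cor \<delta>) > 0"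
proof -
  have \<alpha>R: "\<alpha> \<in> R" using assms Rp_subset by auto
  obtain a where a: "\<And>\<epsilon>. \<epsilon> \<in> \<Delta> \<Longrightarrow> a \<epsilon> \<ge> 0" "\<alpha> = (\<Sum>\<epsilon>\<in>\<Delta>. a \<epsilon> *\<^sub>R \<epsilon>)"
    using positive_combination assms by blast
  have "(\<Sum>\<epsilon>\<in>\<Delta>. a \<epsilon> * blinfun_apply \<epsilon> (cor \<alpha>)) = blinfun_apply \<alpha> (cor \<alpha>)"
    by (subst (2) a(2)) (simp add: blinfun.sum_left blinfun.scaleR_left)
  also have "\<dots> > 0" using \<alpha>R by simp
  finally obtain \<delta> where \<delta>: "\<delta> \<in> \<Delta>" "a \<delta> * blinfun_apply \<delta> (cor \<alpha>) > 0"
    by (meson not_less sum_nonpos)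
  then have pos: "blinfun_apply \<delta> (cor \<alpha>) > 0"
    using a(1)[OF \<delta>(1)] by (simp add: zero_less_mult_iff)
  have \<delta>R: "\<delta> \<in> R" using \<delta>(1) Delta_subset Rp_subset by auto
  have nz: "cor \<delta> \<bullet> cor \<delta> > 0" "cor \<alpha> \<bullet> cor \<alpha> > 0" using cor_nonzero \<delta>R \<alpha>R by simp_all
  have "blinfun_apply \<alpha> (cor \<delta>) * (cor \<alpha> \<bullet> cor \<alpha>) = blinfun_apply \<delta> (cor \<alpha>) * (cor \<delta> \<bullet> cor \<delta>)"
    by (simp add: root_apply \<delta>R \<alpha>R inner_commute)
  also have "\<dots> > 0" using pos nz by simp
  finally have "blinfun_apply \<alpha> (cor \<delta>) > 0" using nz by (simp add: zero_less_mult_iff)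
  with \<delta>(1) show thesis by (rule that)
qed

text \<open>The induction is on the value at the regular vector defining the positive system.\<close>

lemma positive_root_induct [consumes 1, case_names simple step]:
  assumes "\<alpha> \<in> Rp"
    and simple: "\<And>\<delta>. \<delta> \<in> \<Delta> \<Longrightarrow> P \<delta>"
    and step: "\<And>\<delta> \<beta>. \<delta> \<in> \<Delta> \<Longrightarrow> \<beta> \<in> Rp \<Longrightarrow> P \<beta> \<Longrightarrow> P (root_refl cor \<delta> \<beta>)"
  shows "P \<alpha>"
proof -
  obtain x where x: "\<And>\<alpha>. \<alpha> \<in> Rp \<Longrightarrow> blinfun_apply \<alpha> x > 0"
    using positive by (auto simp: positive_system_def)
  show ?thesis
    using assms(1)
  \<comment> \<open>Real values are not well-founded by themselves; the number of positive roots
    with a smaller value is a natural number that drops with them.\<close>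
  proof (induction "card {\<beta> \<in> Rp. blinfun_apply \<beta> x < blinfun_apply \<alpha> x}" arbitrary: \<alpha> rule: less_induct)
    case less
    show ?case
    proof (cases "\<alpha> \<in> \<Delta>")
      case False
      obtain \<delta> where \<delta>: "\<delta> \<in> \<Delta>" "blinfun_apply \<alpha> (cor \<delta>) > 0"
        using simple_root_acute less.prems by blast
      have \<delta>Rp: "\<delta> \<in> Rp" using \<delta> Delta_subset by auto
      define \<beta> where "\<beta> = root_refl cor \<delta> \<alpha>"
      have \<beta>: "\<beta> \<in> Rp" using root_refl_simple[OF \<delta>(1) less.prems] False \<delta>(1) by (auto simp: \<beta>_def)
      have "blinfun_apply \<beta> x < blinfun_apply \<alpha> x"
        using \<delta>(2) x[OF \<delta>Rp] by (simp add: \<beta>_def blinfun.diff_left blinfun.scaleR_left)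
      then have "{\<gamma> \<in> Rp. blinfun_apply \<gamma> x < blinfun_apply \<beta> x} \<subset> {\<gamma> \<in> Rp. blinfun_apply \<gamma> x < blinfun_apply \<alpha> x}"
        using \<beta> by auto
      then have "P \<beta>" using less.hyps \<beta> finite_Rp by (simp add: psubset_card_mono)
      then have "P (root_refl cor \<delta> \<beta>)" by (rule step[OF \<delta>(1) \<beta>])
      moreover have "root_refl cor \<delta> \<beta> = \<alpha>"
        unfolding \<beta>_def using \<delta>Rp Rp_subset by (intro root_refl_root_refl) auto
      ultimately show ?thesis by simp
    qed (rule simple)
  qed
qed

end

section \<open>The square of the sum of the reflections\<close>

locale invariant_root_system = simple_root_system R cor Rp \<Delta>
  for R :: "'v::euclidean_space dual set" and cor :: "'v dual \<Rightarrow> 'v" and Rp \<Delta> +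
  fixes c :: "'v dual \<Rightarrow> complex"
  assumes invariant: "invariant_parameter R cor Rp c"
begin

abbreviation C\<^sub>2 :: "'v clifford \<Rightarrow>\<^sub>0 complex" where "C\<^sub>2 \<equiv> C2_element R cor Rp c"

lemma C2_eq: "C\<^sub>2 = (\<Sum>\<alpha>\<in>Rp. \<Sum>\<beta>\<in>Rp. Poly_Mapping.single (s_tilde cor \<alpha> * s_tilde cor \<beta>) (1 / 4 * c \<alpha> * c \<beta>))"
  by (simp add: C2_element_def W_tilde_def)

lemma keys_C2: "Poly_Mapping.keys C\<^sub>2 \<subseteq> carrier (W_tilde R cor)"
proof -
  have "Poly_Mapping.keys C\<^sub>2 \<subseteq> (\<Union>\<alpha>\<in>Rp. \<Union>\<beta>\<in>Rp. {s_tilde cor \<alpha> * s_tilde cor \<beta>})"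
    unfolding C2_eq
    by (intro order_trans[OF keys_sum] UN_mono order_refl) (simp add: keys_single)
  then show ?thesis using s_tilde_mult_in_W_tilde Rp_subset by blast
qed

lemma invariant_root_refl:
  assumes "\<gamma> \<in> R" "\<alpha> \<in> Rp" "root_refl cor \<gamma> \<alpha> \<in> Rp"
  shows "c (root_refl cor \<gamma> \<alpha>) = c \<alpha>"
proof -
  have "\<forall>y. blinfun_apply (root_refl cor \<gamma> \<alpha>) (reflection cor \<gamma> y) = blinfun_apply \<alpha> y"
    using reflection_reflection[OF assms(1)] unfolding root_refl_apply by (metis comp_apply id_apply)
  then show ?thesis
    using invariant assms reflection_in_refl_group unfolding invariant_parameter_def by blast
qed

text \<open>The products of the double sum with \<open>?g\<close> on the right (\<open>F\<close>)
  and on the left (\<open>G\<close>) are matched pair by pair, after splitting off the index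
  \<delta> in both variables.\<close>

lemma commutes_simple:
  assumes \<delta>: "\<delta> \<in> \<Delta>"
  shows "commutes C\<^sub>2 (s_tilde cor \<delta>)"
proof -
  let ?g = "s_tilde cor \<delta>" and ?s = "s_tilde cor" and ?\<sigma> = "root_refl cor \<delta>" and ?P = "Rp - {\<delta>}"
  define q where "q \<alpha> \<beta> = 1 / 4 * c \<alpha> * c \<beta>" for \<alpha> \<beta>
  define F where "F \<alpha> \<beta> = Poly_Mapping.single (?s \<alpha> * ?s \<beta> * ?g) (q \<alpha> \<beta>)" for \<alpha> \<beta>
  define G where "G \<alpha> \<beta> = Poly_Mapping.single (?g * (?s \<alpha> * ?s \<beta>)) (q \<alpha> \<beta>)" for \<alpha> \<beta>
  have \<delta>Rp: "\<delta> \<in> Rp" and \<delta>R: "\<delta> \<in> R" using \<delta> Delta_subset Rp_subset by auto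
  have split: "(\<Sum>\<alpha>\<in>Rp. \<Sum>\<beta>\<in>Rp. H \<alpha> \<beta>)
      = (\<Sum>\<alpha>\<in>?P. \<Sum>\<beta>\<in>?P. H \<alpha> \<beta>) + (\<Sum>\<alpha>\<in>?P. H \<alpha> \<delta> + H \<delta> \<alpha>) + H \<delta> \<delta>"
    for H :: "_ \<Rightarrow> _ \<Rightarrow> 'v clifford \<Rightarrow>\<^sub>0 complex"
    by (simp add: sum.remove[OF finite_Rp \<delta>Rp] sum.distrib add_ac)
  have q_sym: "q \<alpha> \<beta> = q \<beta> \<alpha>" for \<alpha> \<beta> by (simp add: q_def)
  have "F (?\<sigma> \<alpha>) (?\<sigma> \<beta>) = G \<alpha> \<beta>" if "\<alpha> \<in> ?P" "\<beta> \<in> ?P" for \<alpha> \<beta>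
  proof -
    have mem: "\<alpha> \<in> R" "\<beta> \<in> R" "?\<sigma> \<alpha> \<in> Rp" "?\<sigma> \<beta> \<in> Rp"
      using that Rp_subset root_refl_simple[OF \<delta>] by auto
    \<comment> \<open>Passing \<open>?g\<close> across each of the two factors costs one sign, and
      the two signs cancel.\<close>
    have "?g * (?s \<alpha> * ?s \<beta>) = - (?s (?\<sigma> \<alpha>) * (?g * ?s \<beta>))"
      by (simp only: mult.assoc[symmetric] s_tilde_commute[OF \<delta>R mem(1)] mult_minus_left)
    also have "\<dots> = ?s (?\<sigma> \<alpha>) * ?s (?\<sigma> \<beta>) * ?g"
      by (simp only: s_tilde_commute[OF \<delta>R mem(2)] mult_minus_right minus_minus mult.assoc)
    finally show ?thesis
      using that mem by (simp only: F_def G_def q_def invariant_root_refl[OF \<delta>R] Diff_iff)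
  qed
  then have "(\<Sum>\<alpha>\<in>?P. \<Sum>\<beta>\<in>?P. G \<alpha> \<beta>) = (\<Sum>\<alpha>\<in>?P. \<Sum>\<beta>\<in>?P. F (?\<sigma> \<alpha>) (?\<sigma> \<beta>))"
    by (intro sum.cong refl) simp
  also have "\<dots> = (\<Sum>\<alpha>\<in>?P. \<Sum>\<beta>\<in>?P. F \<alpha> \<beta>)"
    using sum.reindex_bij_betw[OF bij_betw_root_refl_simple[OF \<delta>], where g = "\<lambda>\<alpha>. \<Sum>\<beta>\<in>?P. F \<alpha> \<beta>"]
    by (simp only: sum.reindex_bij_betw[OF bij_betw_root_refl_simple[OF \<delta>]])
  finally have PP: "(\<Sum>\<alpha>\<in>?P. \<Sum>\<beta>\<in>?P. F \<alpha> \<beta>) = (\<Sum>\<alpha>\<in>?P. \<Sum>\<beta>\<in>?P. G \<alpha> \<beta>)" ..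
  have gg: "?g * ?g = 1" "?g * (?g * y) = y" for y
    by (simp_all add: s_tilde_square[OF \<delta>R] flip: mult.assoc)
  \<comment> \<open>In the first equation both basis elements reduce to \<open>?s \<alpha>\<close>,
    since \<open>?g\<close> squares to 1; in the second both are
    \<open>?g * ?s \<alpha> * ?g\<close>. The coefficients agree by symmetry of \<open>q\<close>, so
    the two mixed sums trade places.\<close>
  have "F \<alpha> \<delta> = G \<delta> \<alpha>" "F \<delta> \<alpha> = G \<alpha> \<delta>" for \<alpha>
    by (simp_all add: F_def G_def mult.assoc gg q_sym[of \<alpha>])
  then have "(\<Sum>\<alpha>\<in>Rp. \<Sum>\<beta>\<in>Rp. F \<alpha> \<beta>) = (\<Sum>\<alpha>\<in>Rp. \<Sum>\<beta>\<in>Rp. G \<alpha> \<beta>)"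
    unfolding split PP by (simp add: add.commute)
  then show ?thesis
    by (simp add: commutes_def C2_eq linear_extension_sum F_def G_def q_def)
qed

text \<open>Up to the group element \<open>- 1\<close>, the lift of a reflected root is a product of
  lifts already known to commute, so the property climbs from the simple roots.\<close>

lemma commutes_positive:
  assumes "\<alpha> \<in> Rp"
  shows "commutes C\<^sub>2 (s_tilde cor \<alpha>)"
  using assms
proof (induction rule: positive_root_induct)
  case (step \<delta> \<beta>)
  have "\<delta> \<in> R" "\<beta> \<in> R" using step Delta_subset Rp_subset by auto
  then have "s_tilde cor (root_refl cor \<delta> \<beta>) = - 1 * (s_tilde cor \<delta> * s_tilde cor \<beta> * s_tilde cor \<delta>)"
    by (simp only: s_tilde_conj mult_minus_left mult_1_left minus_minus)
  then show ?case
    using step by (simp only: commutes_mult commutes_minus_one commutes_simple)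
qed (rule commutes_simple)

lemma commutes_W_tilde:
  assumes "\<eta> \<in> carrier (W_tilde R cor)"
  shows "commutes C\<^sub>2 \<eta>"
  using assms
proof (induction rule: W_tilde_induct)
  case (root \<alpha>)
  \<comment> \<open>A negative root is handled through its opposite, whose lift differs by the
    factor \<open>- 1\<close>.\<close>
  have "commutes C\<^sub>2 (- 1 * s_tilde cor (- \<alpha>))" if "- \<alpha> \<in> Rp"
    using that by (intro commutes_mult commutes_minus_one commutes_positive)
  then show ?case
    using root positive_or_negative commutes_positive by (auto simp: s_tilde_uminus)
qed (simp_all add: commutes_one commutes_minus_one commutes_mult)

text \<open>The star negates both factors, with cancelling signs, and reverses their order.
  Exchanging the two summations undoes the reversal, and real coefficients survive
  conjugation.\<close>

lemma star_C2_element: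
  assumes "\<forall>\<alpha>\<in>Rp. c \<alpha> \<in> \<real>"
  shows "antilinear_extension cliff_star C\<^sub>2 = C\<^sub>2"
proof -
  have "antilinear_extension cliff_star C\<^sub>2
      = (\<Sum>\<alpha>\<in>Rp. \<Sum>\<beta>\<in>Rp. Poly_Mapping.single (s_tilde cor \<beta> * s_tilde cor \<alpha>) (cnj (1 / 4 * c \<alpha> * c \<beta>)))"
    by (simp add: C2_eq antilinear_extension_sum cliff_star_mult s_tilde_eq_cvec)
  also have "\<dots> = (\<Sum>\<alpha>\<in>Rp. \<Sum>\<beta>\<in>Rp. Poly_Mapping.single (s_tilde cor \<beta> * s_tilde cor \<alpha>) (1 / 4 * c \<beta> * c \<alpha>))"
    using assms by (intro sum.cong refl) (simp add: Reals_cnj_iff mult.commute)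
  also have "\<dots> = C\<^sub>2" unfolding C2_eq by (rule sum.swap)
  finally show ?thesis .
qed

end

theorem proposition6p1:
  fixes R Rp \<Delta> :: "'v::euclidean_space dual set"
    and cor :: "'v dual \<Rightarrow> 'v"
    and c :: "'v dual \<Rightarrow> complex"
    and w0 :: "'v \<Rightarrow> 'v"
  assumes "root_system R cor"
    and "positive_system R Rp"
    and "simple_roots Rp \<Delta>"
    and "longest_element R cor \<Delta> w0"
    and "invariant_parameter R cor Rp c"
    and "\<forall>\<alpha>\<in>Rp. c \<alpha> \<in> \<real>"
  shows "hat_admissible R cor w0 (C2_element R cor Rp c)"
proof -
  interpret invariant_root_system R cor Rp \<Delta> c
    using assms by unfold_locales
  have comm: "linear_extension (\<lambda>x. x * g) C\<^sub>2 = linear_extension (\<lambda>x. g * x) C\<^sub>2"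
    if "g \<in> carrier (W_tilde R cor)" for g
    using commutes_W_tilde[OF that] by (simp only: commutes_def)
  have star: "antilinear_extension cliff_star C\<^sub>2 = C\<^sub>2"
    using assms(6) by (rule star_C2_element)
  \<comment> \<open>Both groups are treated, which settles either branch of the case distinction on
    \<open>w0\<close> in \<open>hat_admissible\<close>.\<close>
  have "admissible (W_tilde_C2 R cor) star_C2 (embed_C2 C\<^sub>2)"
    using keys_C2 comm star by (rule admissible_embed_C2)
  moreover have "central (group_algebra (W_tilde R cor)) C\<^sub>2"
    using keys_C2 comm by (intro central_group_algebra) (simp_all add: W_tilde_def)
  ultimately show ?thesis
    by (simp add: hat_admissible_def admissible_def star)
qed

end
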